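(* Let $\mathcal C$ be a class of partial orders closed under isomorphism such that every member of $\mathcal C$ satisfies VC$^\sharp$. Then every partial order in $\langle\mathcal C\rangle_{\Sigma^r}$ satisfies VC$^\sharp$. In particular, the class $\mathcal C^{\mathrm{VC}^\sharp}$ of all partial orders satisfying VC$^\sharp$ is closed under finite lexicographic sums of rooted summands, i.e. $\langle\mathcal C^{\mathrm{VC}^\sharp}\rangle_{\Sigma^r}=\mathcal C^{\mathrm{VC}^\sharp}$.
   Context: All structures are partial orders in the language $L_b=\langle\le\rangle$; $\mathfrak c=2^{\aleph_0}$. For a partial order $\mathbb X$, $I(\mathbb X)$ is the number of non-isomorphic countable models of $\mathrm{Th}(\mathbb X)$, with $I(\mathbb X)=1$ when $\mathbb X$ is finite; $\mathbb X$ satisfies VC$^\sharp$ iff $I(\mathbb X)\in\{1,\mathfrak c\}$. Lexicographic sum: for a partial order $\mathbb I=\langle I,\le_{\mathbb I}\rangle$ and partial orders $\mathbb X_i$ ($i\in I$) with pairwise disjoint domains, $\sum_{\mathbb I}\mathbb X_i$ is the partial order on $\bigcup_i X_i$ with $x\le x'$ iff either $x,x'\in X_i$ and $x\le_{\mathbb X_i}x'$, or $x\in X_i$, $x'\in X_j$ with $i<_{\mathbb I}j$. For a partial order $\mathbb X$, $1+\mathbb X$ is obtained by adding a new element below all elements of $X$; the rooted $\mathbb X$ is $\mathbb X_r=\mathbb X$ if $\mathbb X$ has a smallest element and $\mathbb X_r=1+\mathbb X$ otherwise. For a finite partial order $\mathbb I$, $\sum^r_{\mathbb I}\mathbb X_i:=\sum_{\mathbb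 I}(\mathbb X_i)_r$ (copies taken with pairwise disjoint domains). For an isomorphism-closed class $\mathcal C$ of partial orders, $\langle\mathcal C\rangle_{\Sigma^r}=\bigcup_{n\in\omega}\mathcal C_n$, where $\mathcal C_0=\mathcal C$ and $\mathcal C_{n+1}$ is the class of all partial orders isomorphic to some $\sum_{\mathbb I}(\mathbb X_i)_r$ with $\mathbb I$ a finite partial order, each $\mathbb X_i\in\bigcup_{m\le n}\mathcal C_m$, and the $(X_i)_r$ pairwise disjoint. *)

theory Defs
  imports Main
begin

unbundle cardinal_syntax

text \<open>
  A partial order is a relation \<open>r\<close> with \<open>Partial_order r\<close>, its domain being \<open>Field r\<close> (which is the
  whole domain, by reflexivity).  The empty order is admitted.
\<close>

definition ord_isomorphic :: "'a rel \<Rightarrow> 'b rel \<Rightarrow> bool" where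
  "ord_isomorphic r s \<longleftrightarrow>
     (\<exists>f. bij_betw f (Field r) (Field s) \<and>
          (\<forall>x\<in>Field r. \<forall>y\<in>Field r. (x, y) \<in> r \<longleftrightarrow> (f x, f y) \<in> s))"

definition iso_closed :: "'a rel set \<Rightarrow> bool" where
  "iso_closed \<C> \<longleftrightarrow> (\<forall>r\<in>\<C>. \<forall>s. ord_isomorphic r s \<longrightarrow> s \<in> \<C>)"


section \<open>First-order logic of one binary relation symbol\<close>

text \<open>Variables are natural numbers; \<open>Exists n \<phi>\<close> binds the variable \<open>n\<close>.\<close>

datatype fm = Leq nat nat | Equal nat nat | Neg fm | Conj fm fm | Exists nat fm

primrec fvars :: "fm \<Rightarrow> nat set" where
  "fvars (Leq m n) = {m, n}"
| "fvars (Equal m n) = {m, n}"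
| "fvars (Neg \<phi>) = fvars \<phi>"
| "fvars (Conj \<phi> \<psi>) = fvars \<phi> \<union> fvars \<psi>"
| "fvars (Exists n \<phi>) = fvars \<phi> - {n}"

primrec sat :: "'a rel \<Rightarrow> (nat \<Rightarrow> 'a) \<Rightarrow> fm \<Rightarrow> bool" where
  "sat r e (Leq m n) \<longleftrightarrow> (e m, e n) \<in> r"
| "sat r e (Equal m n) \<longleftrightarrow> e m = e n"
| "sat r e (Neg \<phi>) \<longleftrightarrow> \<not> sat r e \<phi>"
| "sat r e (Conj \<phi> \<psi>) \<longleftrightarrow> sat r e \<phi> \<and> sat r e \<psi>"
| "sat r e (Exists n \<phi>) \<longleftrightarrow> (\<exists>x\<in>Field r. sat r (e(n := x)) \<phi>)"

text \<open>
  The truth value of a sentence does not depend on the valuation, so the valuations below need not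
  be restricted to the domain; this also gives the empty order its intended theory.
\<close>

definition Th :: "'a rel \<Rightarrow> fm set" where
  "Th r = {\<phi>. fvars \<phi> = {} \<and> (\<forall>e. sat r e \<phi>)}"

definition models :: "'a rel \<Rightarrow> fm set \<Rightarrow> bool" where
  "models r T \<longleftrightarrow> (\<forall>\<phi>\<in>T. \<forall>e. sat r e \<phi>)"


section \<open>The number of countable models\<close>

text \<open>Every countable model is isomorphic to one whose domain is a subset of \<open>nat\<close>.\<close>

definition countable_models :: "'a rel \<Rightarrow> nat rel set" where
  "countable_models r = {s. Partial_order s \<and> models s (Th r)}"

definition countable_model_types :: "'a rel \<Rightarrow> nat rel set set" where
  "countable_model_types r =
     countable_models r //
       {(s, t). s \<in> countable_models r \<and> t \<in> countable_models r \<and> ord_isomorphic s t}"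

text \<open>
  Cardinals are represented by cardinal orders, compared by \<open>=o\<close>; \<open>|{{}}|\<close> is the cardinal 1 at
  the required type.
\<close>

definition num_models :: "'a rel \<Rightarrow> nat rel set rel" where
  "num_models r = (if finite (Field r) then |{{}}| else |countable_model_types r| )"

definition VC_sharp :: "'a rel \<Rightarrow> bool" where
  "VC_sharp r \<longleftrightarrow> num_models r =o cone \<or> num_models r =o ctwo ^c natLeq"

definition VC_sharp_class :: "'a rel set" where
  "VC_sharp_class = {r. Partial_order r \<and> VC_sharp r}"


section \<open>Lexicographic sums of rooted orders\<close>

definition copy :: "('a \<Rightarrow> 'b) \<Rightarrow> 'a rel \<Rightarrow> 'b rel" where
  "copy f r = map_prod f f ` r"

definition has_least :: "'a rel \<Rightarrow> bool" where
  "has_least r \<longleftrightarrow> (\<exists>x\<in>Field r. \<forall>y\<in>Field r. (x, y) \<in> r)"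

text \<open>\<open>None\<close> is the new element below the copy of \<open>r\<close> along \<open>Some\<close>.\<close>

definition one_plus :: "'a rel \<Rightarrow> 'a option rel" where
  "one_plus r = {(None, None)} \<union> {None} \<times> Some ` Field r \<union> copy Some r"

definition rooted :: "'a rel \<Rightarrow> 'a option rel" where
  "rooted r = (if has_least r then copy Some r else one_plus r)"

text \<open>The fields of the summands are meant to be pairwise disjoint.\<close>

definition lex_sum :: "'i rel \<Rightarrow> ('i \<Rightarrow> 'b rel) \<Rightarrow> 'b rel" where
  "lex_sum I X =
     {(x, x'). (\<exists>i\<in>Field I. (x, x') \<in> X i) \<or>
               (\<exists>i j. (i, j) \<in> I \<and> i \<noteq> j \<and> x \<in> Field (X i) \<and> x' \<in> Field (X j))}"

definition rooted_sum :: "'i rel \<Rightarrow> ('i \<Rightarrow> 'a rel) \<Rightarrow> ('i \<times> 'a option) rel" where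
  "rooted_sum I X = lex_sum I (\<lambda>i. copy (Pair i) (rooted (X i)))"

text \<open>
  Up to isomorphism every finite index order lives on \<open>nat\<close>.  For infinite \<open>'a\<close> each finite sum of
  rooted orders on \<open>'a\<close> has an isomorphic copy on \<open>'a\<close>.
\<close>

definition rooted_sums :: "'a rel set \<Rightarrow> 'a rel set" where
  "rooted_sums \<D> =
     {s. Partial_order s \<and>
         (\<exists>(I :: nat rel) X. Partial_order I \<and> finite (Field I) \<and>
            (\<forall>i\<in>Field I. X i \<in> \<D>) \<and> ord_isomorphic s (rooted_sum I X))}"

fun sum_level :: "'a rel set \<Rightarrow> nat \<Rightarrow> 'a rel set" where
  "sum_level \<C> 0 = \<C>"
| "sum_level \<C> (Suc n) = rooted_sums (\<Union>m\<in>{..n}. sum_level \<C> m)"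

definition rooted_sum_closure :: "'a rel set \<Rightarrow> 'a rel set" where
  "rooted_sum_closure \<C> = (\<Union>n. sum_level \<C> n)"

end

theory Submission
  imports Defs "HOL-Library.Countable_Set"
begin

text \<open>
  Let \<open>S\<close> be a finite lexicographic sum of rooted orders \<open>X i\<close> satisfying VC-sharp; only the case of
  infinite \<open>S\<close> matters.  By a Feferman-Vaught argument, replacing each \<open>X i\<close> by an elementarily
  equivalent countable order yields a model of the theory of \<open>S\<close>.

  If some \<open>X i\<close> has continuum many countable models, varying this summand yields continuum many
  models of the theory of \<open>S\<close>: in a countable order a summand is determined by the finite tuple of
  roots, so that at most countably many choices of the summand lead to isomorphic sums.

  Otherwise each \<open>X i\<close> is finite or \<open>\<omega>\<close>-categorical.  By the Ryll-Nardzewski theorem (omitting types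
  and compactness, both by one Henkin construction) and back-and-forth, the automorphism group of a
  countable \<open>\<omega>\<close>-categorical order has finitely many orbits on tuples of each length.  Automorphisms of
  the summands glue to automorphisms of the sum, so the sum has the same property and is
  \<open>\<omega>\<close>-categorical or finite.
\<close>


section \<open>Formulas\<close>

text \<open>Roots are what makes the counting possible. In general a summand cannot be cut out of a
  sum by finitely many parameters, but once the images of all least elements are fixed, the order
  delimits each summand. An isomorphism between two sums need not respect the given decompositions,
  so nothing is claimed about where roots go; it suffices that a countable order has only countably
  many finite tuples. Rooting itself may lose information, namely whether the least element was
  added. Elementary equivalence restores it, since having a least element is a first-order property.

  The other case works with automorphisms because those of the summands glue directly; types serve
  only to link orbits with uniqueness of the countable model. Countable models of the summands need
  no Loewenheim-Skolem argument: a count that is 1 or the continuum is not 0.\<close>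

instance fm :: countable
  by countable_datatype

lemma finite_fvars [simp]: "finite (fvars \<phi>)"
  by (induction \<phi>) auto

lemma sat_cong: "(\<And>v. v \<in> fvars \<phi> \<Longrightarrow> e v = f v) \<Longrightarrow> sat r e \<phi> = sat r f \<phi>"
proof (induction \<phi> arbitrary: e f)
  case (Exists n \<phi>)
  have "sat r (e(n := x)) \<phi> = sat r (f(n := x)) \<phi>" for x
    by (rule Exists.IH) (use Exists.prems in auto)
  then show ?case by simp
next
  case (Conj \<phi> \<psi>)
  have "sat r e \<phi> = sat r f \<phi>" by (rule Conj.IH) (use Conj.prems in auto)
  moreover have "sat r e \<psi> = sat r f \<psi>" by (rule Conj.IH) (use Conj.prems in auto)
  ultimately show ?case by simp
next
  case (Neg \<phi>)
  have "sat r e \<phi> = sat r f \<phi>" by (rule Neg.IH) (use Neg.prems in auto)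
  then show ?case by simp
qed auto

text \<open>The bound variable is moved away from the images of the free variables, so capture is
  avoided for every \<sigma>, injective or not. Non-injective renamings do occur: they put Henkin
  constants in place of variables and read off tuples with repeated entries.\<close>

primrec ren :: "fm \<Rightarrow> (nat \<Rightarrow> nat) \<Rightarrow> fm" where
  "ren (Leq m n) \<sigma> = Leq (\<sigma> m) (\<sigma> n)"
| "ren (Equal m n) \<sigma> = Equal (\<sigma> m) (\<sigma> n)"
| "ren (Neg \<phi>) \<sigma> = Neg (ren \<phi> \<sigma>)"
| "ren (Conj \<phi> \<psi>) \<sigma> = Conj (ren \<phi> \<sigma>) (ren \<psi> \<sigma>)"
| "ren (Exists n \<phi>) \<sigma> =
     (let c = (SOME c. c \<notin> \<sigma> ` (fvars \<phi> - {n})) in Exists c (ren \<phi> (\<sigma>(n := c))))"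

lemma ren_Exists:
  obtains c where "c \<notin> \<sigma> ` (fvars \<phi> - {n})"
    and "ren (Exists n \<phi>) \<sigma> = Exists c (ren \<phi> (\<sigma>(n := c)))"
proof -
  have "finite (\<sigma> ` (fvars \<phi> - {n}))" by simp
  then have "\<exists>c. c \<notin> \<sigma> ` (fvars \<phi> - {n})" by (rule ex_new_if_finite[OF infinite_UNIV_nat])
  then have "(SOME c. c \<notin> \<sigma> ` (fvars \<phi> - {n})) \<notin> \<sigma> ` (fvars \<phi> - {n})" by (rule someI_ex)
  then show thesis by (rule that) (simp add: Let_def)
qed

lemma sat_ren: "sat r e (ren \<phi> \<sigma>) = sat r (e \<circ> \<sigma>) \<phi>"
proof (induction \<phi> arbitrary: e \<sigma>)
  case (Exists n \<phi>)
  obtain c where c: "c \<notin> \<sigma> ` (fvars \<phi> - {n})"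
    and eq: "ren (Exists n \<phi>) \<sigma> = Exists c (ren \<phi> (\<sigma>(n := c)))"
    by (rule ren_Exists)
  have "sat r (e(c := x)) (ren \<phi> (\<sigma>(n := c))) = sat r ((e \<circ> \<sigma>)(n := x)) \<phi>" for x
    unfolding Exists.IH by (rule sat_cong) (use c in auto)
  then show ?case unfolding eq by (simp add: comp_def)
qed (simp_all del: ren.simps(5))

lemma fvars_ren: "fvars (ren \<phi> \<sigma>) = \<sigma> ` fvars \<phi>"
proof (induction \<phi> arbitrary: \<sigma>)
  case (Exists n \<phi>)
  obtain c where c: "c \<notin> \<sigma> ` (fvars \<phi> - {n})"
    and eq: "ren (Exists n \<phi>) \<sigma> = Exists c (ren \<phi> (\<sigma>(n := c)))"
    by (rule ren_Exists)
  show ?case unfolding eq fvars.simps Exists.IH using c by auto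
qed auto

section \<open>Finite conjunctions, truth patterns and blocks of quantifiers\<close>

definition Verum :: fm where
  "Verum = Neg (Exists 0 (Neg (Equal 0 0)))"

lemma sat_Verum [simp]: "sat r e Verum" and fvars_Verum [simp]: "fvars Verum = {}"
  by (simp_all add: Verum_def)

definition Conjs :: "fm list \<Rightarrow> fm" where
  "Conjs \<phi>s = foldr Conj \<phi>s Verum"

lemma sat_Conjs [simp]: "sat r e (Conjs \<phi>s) \<longleftrightarrow> (\<forall>\<phi>\<in>set \<phi>s. sat r e \<phi>)"
  unfolding Conjs_def by (induction \<phi>s) auto

lemma fvars_Conjs [simp]: "fvars (Conjs \<phi>s) = (\<Union>\<phi>\<in>set \<phi>s. fvars \<phi>)"
  unfolding Conjs_def by (induction \<phi>s) auto

text \<open>The diagram of a finite \<open>W\<close> under valuations for which \<open>S\<close>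
  contains exactly the true members of \<open>W\<close>. A conjunction needs a list, hence the
  choice of an enumeration.\<close>

definition truth_pattern :: "fm set \<Rightarrow> fm set \<Rightarrow> fm" where
  "truth_pattern W S =
     Conjs (map (\<lambda>\<psi>. if \<psi> \<in> S then \<psi> else Neg \<psi>) (SOME \<psi>s. set \<psi>s = W))"

lemma
  assumes "finite W"
  shows sat_truth_pattern: "sat r e (truth_pattern W S) \<longleftrightarrow> (\<forall>\<psi>\<in>W. sat r e \<psi> \<longleftrightarrow> \<psi> \<in> S)"
    and fvars_truth_pattern: "fvars (truth_pattern W S) = (\<Union>\<psi>\<in>W. fvars \<psi>)"
proof -
  have W: "set (SOME \<psi>s. set \<psi>s = W) = W"
    using finite_list[OF assms] by (rule someI_ex)
  have "sat r e (truth_pattern W S) \<longleftrightarrow>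
      (\<forall>\<phi>\<in>(\<lambda>\<psi>. if \<psi> \<in> S then \<psi> else Neg \<psi>) ` W. sat r e \<phi>)"
    unfolding truth_pattern_def sat_Conjs set_map W ..
  also have "\<dots> \<longleftrightarrow> (\<forall>\<psi>\<in>W. sat r e \<psi> \<longleftrightarrow> \<psi> \<in> S)"
    unfolding ball_simps(9) by (rule ball_cong) auto
  finally show "sat r e (truth_pattern W S) \<longleftrightarrow> (\<forall>\<psi>\<in>W. sat r e \<psi> \<longleftrightarrow> \<psi> \<in> S)" .
  show "fvars (truth_pattern W S) = (\<Union>\<psi>\<in>W. fvars \<psi>)"
    unfolding truth_pattern_def fvars_Conjs set_map W by (auto split: if_splits)
qed

definition Exs :: "nat list \<Rightarrow> fm \<Rightarrow> fm" where
  "Exs vs \<phi> = foldr Exists vs \<phi>"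

lemma fvars_Exs [simp]: "fvars (Exs vs \<phi>) = fvars \<phi> - set vs"
  unfolding Exs_def by (induction vs) auto

lemma sat_Exs:
  "sat r e (Exs vs \<phi>) \<longleftrightarrow>
     (\<exists>f. f ` set vs \<subseteq> Field r \<and> sat r (override_on e f (set vs)) \<phi>)"
proof (induction vs arbitrary: e)
  case Nil
  then show ?case by (simp add: Exs_def)
next
  case (Cons v vs)
  have "sat r e (Exs (v # vs) \<phi>) \<longleftrightarrow> (\<exists>x\<in>Field r. sat r (e(v := x)) (Exs vs \<phi>))"
    by (simp add: Exs_def)
  also have "\<dots> \<longleftrightarrow> (\<exists>f. f ` set (v # vs) \<subseteq> Field r \<and> sat r (override_on e f (set (v # vs))) \<phi>)"
    (is "?L \<longleftrightarrow> ?R")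
  proof
    assume ?L
    then obtain x f where x: "x \<in> Field r" and f: "f ` set vs \<subseteq> Field r"
      "sat r (override_on (e(v := x)) f (set vs)) \<phi>"
      unfolding Cons.IH by blast
    \<comment> \<open>If \<open>v\<close> occurs again in \<open>vs\<close>, the inner quantifier
      overrides the outer one, so \<open>f\<close> takes precedence over \<open>x\<close>.\<close>
    let ?f = "override_on (\<lambda>_. x) f (set vs)"
    have "?f ` set (v # vs) \<subseteq> Field r" using x f(1) by (auto simp: override_on_def)
    moreover have "override_on e ?f (set (v # vs)) = override_on (e(v := x)) f (set vs)"
      by (auto simp: override_on_def fun_eq_iff)
    ultimately show ?R using f(2) by metis
  next
    assume ?R
    then obtain f where f: "f ` set (v # vs) \<subseteq> Field r" "sat r (override_on e f (set (v # vs))) \<phi>"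
      by blast
    moreover have "override_on e f (set (v # vs)) = override_on (e(v := f v)) f (set vs)"
      by (auto simp: override_on_def fun_eq_iff)
    ultimately have "f v \<in> Field r" "sat r (e(v := f v)) (Exs vs \<phi>)"
      unfolding Cons.IH by auto
    then show ?L by blast
  qed
  finally show ?case .
qed


section \<open>Elementary equivalence\<close>

lemma sat_sentence: "fvars \<phi> = {} \<Longrightarrow> sat r e \<phi> = sat r f \<phi>"
  by (rule sat_cong) simp

lemma Th_eq_iff:
  "Th r = Th s \<longleftrightarrow> (\<forall>\<phi> e f. fvars \<phi> = {} \<longrightarrow> sat r e \<phi> = sat s f \<phi>)" (is "?L \<longleftrightarrow> ?R")
proof
  assume L: ?L
  show ?R
  proof (intro allI impI)
    fix \<phi> e f
    assume \<phi>: "fvars \<phi> = {}"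
    have "\<phi> \<in> Th r \<longleftrightarrow> sat r e \<phi>" "\<phi> \<in> Th s \<longleftrightarrow> sat s f \<phi>"
      using \<phi> sat_sentence[OF \<phi>] unfolding Th_def by blast+
    then show "sat r e \<phi> = sat s f \<phi>" using L by simp
  qed
next
  assume ?R
  then show ?L unfolding Th_def by blast
qed

text \<open>\<open>Th r\<close> is complete: a sentence failing in \<open>r\<close> has its negation
  there, so a model of \<open>Th r\<close> satisfies no further sentence.\<close>

lemma models_Th_iff: "models s (Th r) \<longleftrightarrow> Th s = Th r"
proof
  assume m: "models s (Th r)"
  have "sat s e \<phi> = sat r f \<phi>" if \<phi>: "fvars \<phi> = {}" for \<phi> e f
  proof (cases "sat r f \<phi>")
    case True
    then have "\<phi> \<in> Th r" using \<phi> sat_sentence[OF \<phi>] unfolding Th_def by blast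
    then show ?thesis using m True by (auto simp: models_def)
  next
    case False
    then have "Neg \<phi> \<in> Th r" using \<phi> sat_sentence[OF \<phi>] unfolding Th_def by auto
    then show ?thesis using m False by (auto simp: models_def)
  qed
  then show "Th s = Th r" unfolding Th_eq_iff by blast
next
  assume "Th s = Th r"
  then show "models s (Th r)" by (auto simp: models_def Th_def)
qed

lemma countable_models_iff: "s \<in> countable_models r \<longleftrightarrow> Partial_order s \<and> Th s = Th r"
  by (simp add: countable_models_def models_Th_iff)

text \<open>Existential closure turns the formula into a sentence. Quantifying over all of
  \<open>V\<close>, not merely over the free variables, brings the new valuation into
  \<open>Field s\<close> on the whole of \<open>V\<close>.\<close>

lemma satisfiable_transfer:
  assumes Th: "Th r = Th s" and V: "finite V" "fvars \<phi> \<subseteq> V"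
    and e: "e ` V \<subseteq> Field r" "sat r e \<phi>"
  obtains f where "f ` V \<subseteq> Field s" and "sat s f \<phi>"
proof -
  obtain vs where vs: "set vs = V" using finite_list[OF V(1)] by blast
  have "override_on e e V = e" by (simp add: override_on_def fun_eq_iff)
  then have "sat r e (Exs vs \<phi>)"
    unfolding sat_Exs vs using e by (intro exI[of _ e]) simp
  moreover have "fvars (Exs vs \<phi>) = {}" using vs V(2) by auto
  ultimately have "sat s undefined (Exs vs \<phi>)"
    using Th unfolding Th_eq_iff by blast
  then obtain f where f: "f ` V \<subseteq> Field s" "sat s (override_on undefined f V) \<phi>"
    unfolding sat_Exs vs by blast
  have "sat s (override_on undefined f V) \<phi> = sat s f \<phi>"
    by (rule sat_cong) (use V(2) in auto)
  then show thesis using f that by simp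
qed

lemma valid_transfer:
  assumes Th: "Th r = Th s" and V: "finite V" "fvars \<phi> \<subseteq> V"
    and valid: "\<And>e. e ` V \<subseteq> Field r \<Longrightarrow> sat r e \<phi>" and f: "f ` V \<subseteq> Field s"
  shows "sat s f \<phi>"
proof (rule ccontr)
  assume "\<not> sat s f \<phi>"
  then have "sat s f (Neg \<phi>)" by simp
  moreover have "fvars (Neg \<phi>) \<subseteq> V" using V(2) by simp
  ultimately obtain e where "e ` V \<subseteq> Field r" "sat r e (Neg \<phi>)"
    using satisfiable_transfer[OF Th[symmetric] V(1) _ f] by metis
  then show False using valid by simp
qed


section \<open>Isomorphisms\<close>

definition ord_iso :: "('a \<Rightarrow> 'b) \<Rightarrow> 'a rel \<Rightarrow> 'b rel \<Rightarrow> bool" where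
  "ord_iso f r s \<longleftrightarrow> bij_betw f (Field r) (Field s) \<and>
     (\<forall>x\<in>Field r. \<forall>y\<in>Field r. (x, y) \<in> r \<longleftrightarrow> (f x, f y) \<in> s)"

lemma ord_isomorphic_iff: "ord_isomorphic r s \<longleftrightarrow> (\<exists>f. ord_iso f r s)"
  by (simp add: ord_isomorphic_def ord_iso_def)

lemma ord_iso_in_Field: "ord_iso f r s \<Longrightarrow> x \<in> Field r \<Longrightarrow> f x \<in> Field s"
  by (auto simp: ord_iso_def bij_betw_def)

lemma ord_iso_id: "ord_iso id r r"
  by (auto simp: ord_iso_def)

lemma ord_iso_comp: "ord_iso f r s \<Longrightarrow> ord_iso g s t \<Longrightarrow> ord_iso (g \<circ> f) r t"
  using ord_iso_in_Field[of f r s] by (auto simp: ord_iso_def intro: bij_betw_trans)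

lemma ord_iso_inv_into:
  assumes "ord_iso f r s"
  shows "ord_iso (inv_into (Field r) f) s r"
proof -
  have b: "bij_betw f (Field r) (Field s)" using assms by (simp add: ord_iso_def)
  have "(x, y) \<in> s \<longleftrightarrow> (inv_into (Field r) f x, inv_into (Field r) f y) \<in> r"
    if "x \<in> Field s" "y \<in> Field s" for x y
    using assms that bij_betw_inv_into_right[OF b] bij_betw_apply[OF bij_betw_inv_into[OF b]]
    unfolding ord_iso_def by metis
  then show ?thesis using bij_betw_inv_into[OF b] by (simp add: ord_iso_def)
qed

lemma ord_isomorphic_refl: "ord_isomorphic r r"
  unfolding ord_isomorphic_iff by (blast intro: ord_iso_id)

lemma ord_isomorphic_sym: "ord_isomorphic r s \<Longrightarrow> ord_isomorphic s r"
  unfolding ord_isomorphic_iff by (blast intro: ord_iso_inv_into)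

lemma ord_isomorphic_trans:
  "ord_isomorphic r s \<Longrightarrow> ord_isomorphic s t \<Longrightarrow> ord_isomorphic r t"
  unfolding ord_isomorphic_iff by (blast intro: ord_iso_comp)

lemma sat_ord_iso:
  assumes "ord_iso f r s"
  shows "e ` fvars \<phi> \<subseteq> Field r \<Longrightarrow> sat s (f \<circ> e) \<phi> = sat r e \<phi>"
proof (induction \<phi> arbitrary: e)
  case (Equal m n)
  then show ?case using assms by (auto simp: ord_iso_def bij_betw_def inj_on_def)
next
  case (Leq m n)
  then show ?case using assms by (auto simp: ord_iso_def)
next
  case (Exists n \<phi>)
  have *: "sat s ((f \<circ> e)(n := f x)) \<phi> = sat r (e(n := x)) \<phi>" if "x \<in> Field r" for x
  proof -
    have "sat s (f \<circ> e(n := x)) \<phi> = sat r (e(n := x)) \<phi>"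
      by (rule Exists.IH) (use Exists.prems that in auto)
    then show ?thesis by (simp add: fun_upd_comp)
  qed
  have "Field s = f ` Field r" using assms by (simp add: ord_iso_def bij_betw_def)
  then show ?case using * by (simp add: comp_def)
next
  case (Conj \<phi> \<psi>)
  have "e ` fvars \<phi> \<subseteq> Field r" "e ` fvars \<psi> \<subseteq> Field r" using Conj.prems by auto
  then show ?case using Conj.IH by simp
qed auto

lemma Th_isomorphic: "ord_isomorphic r s \<Longrightarrow> Th r = Th s"
proof -
  assume "ord_isomorphic r s"
  then obtain h where h: "ord_iso h r s" by (auto simp: ord_isomorphic_iff)
  have "sat r e \<phi> = sat s f \<phi>" if \<phi>: "fvars \<phi> = {}" for \<phi> e f
    using sat_ord_iso[OF h, of e \<phi>] sat_sentence[OF \<phi>, of s "h \<circ> e" f] \<phi> by simp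
  then show ?thesis unfolding Th_eq_iff by blast
qed

lemma Partial_order_iff:
  "Partial_order r \<longleftrightarrow> (\<forall>x\<in>Field r. (x, x) \<in> r) \<and>
     (\<forall>x y z. (x, y) \<in> r \<longrightarrow> (y, z) \<in> r \<longrightarrow> (x, z) \<in> r) \<and>
     (\<forall>x y. (x, y) \<in> r \<longrightarrow> (y, x) \<in> r \<longrightarrow> x = y)"
  by (auto simp: partial_order_on_def preorder_on_def refl_on_def trans_def antisym_def Field_def)

lemma Partial_order_isomorphic:
  assumes r: "Partial_order r" and "ord_isomorphic r s"
  shows "Partial_order s"
proof -
  obtain g where g: "ord_iso g s r"
    using ord_isomorphic_sym[OF assms(2)] by (auto simp: ord_isomorphic_iff)
  have F: "x \<in> Field s" "y \<in> Field s" if "(x, y) \<in> s" for x y using that by (auto simp: Field_def)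
  have inj: "x = y" if "g x = g y" "x \<in> Field s" "y \<in> Field s" for x y
    using g that by (auto simp: ord_iso_def bij_betw_def inj_on_def)
  have eq: "(x, y) \<in> s \<longleftrightarrow> (g x, g y) \<in> r" if "x \<in> Field s" "y \<in> Field s" for x y
    using g that by (simp add: ord_iso_def)
  have refl: "\<And>x. x \<in> Field r \<Longrightarrow> (x, x) \<in> r"
    and trans: "\<And>x y z. (x, y) \<in> r \<Longrightarrow> (y, z) \<in> r \<Longrightarrow> (x, z) \<in> r"
    and antisym: "\<And>x y. (x, y) \<in> r \<Longrightarrow> (y, x) \<in> r \<Longrightarrow> x = y"
    using r unfolding Partial_order_iff by blast+
  have "(x, x) \<in> s" if "x \<in> Field s" for x
    using eq[OF that that] refl ord_iso_in_Field[OF g that] by simp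
  moreover have "(x, z) \<in> s" if "(x, y) \<in> s" "(y, z) \<in> s" for x y z
    using eq F[OF that(1)] F[OF that(2)] that trans by blast
  moreover have "x = y" if "(x, y) \<in> s" "(y, x) \<in> s" for x y
    using eq F[OF that(1)] that antisym inj by blast
  ultimately show ?thesis unfolding Partial_order_iff by blast
qed

lemma Field_copy: "Field (copy f r) = f ` Field r"
  by (force simp: copy_def Field_def)

lemma ord_iso_copy:
  assumes "inj_on f (Field r)"
  shows "ord_iso f r (copy f r)"
proof -
  have "(x, y) \<in> r" if xy: "x \<in> Field r" "y \<in> Field r" and c: "(f x, f y) \<in> copy f r" for x y
  proof -
    obtain a b where ab: "(a, b) \<in> r" "f a = f x" "f b = f y"
      using c by (auto simp: copy_def)
    then have "a = x" "b = y"
      using inj_onD[OF assms] FieldI1[OF ab(1)] FieldI2[OF ab(1)] xy by blast+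
    then show ?thesis using ab(1) by simp
  qed
  moreover have "(f x, f y) \<in> copy f r" if "(x, y) \<in> r" for x y
    using that by (force simp: copy_def)
  ultimately show ?thesis using assms unfolding ord_iso_def bij_betw_def Field_copy by blast
qed

lemma isomorphic_copy: "inj_on f (Field r) \<Longrightarrow> ord_isomorphic r (copy f r)"
  unfolding ord_isomorphic_iff by (blast intro: ord_iso_copy)

lemma copy_iff: "inj f \<Longrightarrow> (f x, f y) \<in> copy f r \<longleftrightarrow> (x, y) \<in> r"
  by (auto simp: copy_def inj_def)


section \<open>Lexicographic sums\<close>

definition disjoint_summands :: "'i rel \<Rightarrow> ('i \<Rightarrow> 'b rel) \<Rightarrow> bool" where
  "disjoint_summands I X \<longleftrightarrow>
     (\<forall>i\<in>Field I. \<forall>j\<in>Field I. i \<noteq> j \<longrightarrow> Field (X i) \<inter> Field (X j) = {})"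

lemma disjoint_summandsD:
  "disjoint_summands I X \<Longrightarrow> i \<in> Field I \<Longrightarrow> j \<in> Field I \<Longrightarrow> x \<in> Field (X i) \<Longrightarrow> x \<in> Field (X j) \<Longrightarrow>
     i = j"
  unfolding disjoint_summands_def by blast

lemma Field_lex_sum: "Field (lex_sum I X) = (\<Union>i\<in>Field I. Field (X i))"
proof
  show "Field (lex_sum I X) \<subseteq> (\<Union>i\<in>Field I. Field (X i))"
    by (auto simp: lex_sum_def Field_def)
  show "(\<Union>i\<in>Field I. Field (X i)) \<subseteq> Field (lex_sum I X)"
    unfolding lex_sum_def Field_def[of "X _"] by (force intro: FieldI1 FieldI2)
qed

lemma lex_sum_iff:
  assumes "disjoint_summands I X" "i \<in> Field I" "j \<in> Field I" "x \<in> Field (X i)" "y \<in> Field (X j)"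
  shows "(x, y) \<in> lex_sum I X \<longleftrightarrow> (if i = j then (x, y) \<in> X i else (i, j) \<in> I)"
proof -
  have 1: "k = i" if "k \<in> Field I" "x \<in> Field (X k)" for k
    using assms that by (auto simp: disjoint_summands_def)
  have 2: "k = j" if "k \<in> Field I" "y \<in> Field (X k)" for k
    using assms that by (auto simp: disjoint_summands_def)
  have "(\<exists>k\<in>Field I. (x, y) \<in> X k) \<longleftrightarrow> i = j \<and> (x, y) \<in> X i"
  proof
    assume "\<exists>k\<in>Field I. (x, y) \<in> X k"
    then obtain k where k: "k \<in> Field I" "(x, y) \<in> X k" by blast
    then show "i = j \<and> (x, y) \<in> X i"
      using 1[OF k(1) FieldI1[OF k(2)]] 2[OF k(1) FieldI2[OF k(2)]] by simp
  qed (use assms(2) in blast)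
  moreover have "(\<exists>k l. (k, l) \<in> I \<and> k \<noteq> l \<and> x \<in> Field (X k) \<and> y \<in> Field (X l)) \<longleftrightarrow>
      i \<noteq> j \<and> (i, j) \<in> I"
  proof
    assume "\<exists>k l. (k, l) \<in> I \<and> k \<noteq> l \<and> x \<in> Field (X k) \<and> y \<in> Field (X l)"
    then obtain k l where kl: "(k, l) \<in> I" "k \<noteq> l" "x \<in> Field (X k)" "y \<in> Field (X l)" by blast
    then show "i \<noteq> j \<and> (i, j) \<in> I"
      using 1[OF FieldI1[OF kl(1)] kl(3)] 2[OF FieldI2[OF kl(1)] kl(4)] by simp
  qed (use assms(4,5) in blast)
  ultimately show ?thesis unfolding lex_sum_def by simp
qed

lemma Partial_order_lex_sum:
  assumes I: "Partial_order I" and X: "\<And>i. i \<in> Field I \<Longrightarrow> Partial_order (X i)"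
    and d: "disjoint_summands I X"
  shows "Partial_order (lex_sum I X)"
proof -
  let ?S = "lex_sum I X"
  have F: "\<exists>i\<in>Field I. x \<in> Field (X i)" "\<exists>j\<in>Field I. y \<in> Field (X j)" if "(x, y) \<in> ?S" for x y
    using FieldI1[OF that] FieldI2[OF that] by (auto simp: Field_lex_sum)
  have "(x, x) \<in> ?S" if "x \<in> Field ?S" for x
    using that X unfolding Field_lex_sum Partial_order_iff by (auto simp: lex_sum_iff[OF d])
  moreover have "(x, z) \<in> ?S" if xy: "(x, y) \<in> ?S" and yz: "(y, z) \<in> ?S" for x y z
  proof -
    obtain i j k where ijk: "i \<in> Field I" "x \<in> Field (X i)" "j \<in> Field I" "y \<in> Field (X j)"
      "k \<in> Field I" "z \<in> Field (X k)"
      using F[OF xy] F[OF yz] by blast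
    have xy': "if i = j then (x, y) \<in> X i else (i, j) \<in> I"
      and yz': "if j = k then (y, z) \<in> X j else (j, k) \<in> I"
      using xy yz lex_sum_iff[OF d] ijk by blast+
    have "if i = k then (x, z) \<in> X i else (i, k) \<in> I"
      using xy' yz' I X[OF ijk(1)] unfolding Partial_order_iff by metis
    then show ?thesis using lex_sum_iff[OF d] ijk by blast
  qed
  moreover have "x = y" if xy: "(x, y) \<in> ?S" and yx: "(y, x) \<in> ?S" for x y
  proof -
    obtain i j where ij: "i \<in> Field I" "x \<in> Field (X i)" "j \<in> Field I" "y \<in> Field (X j)"
      using F[OF xy] by blast
    have "if i = j then (x, y) \<in> X i else (i, j) \<in> I" "if j = i then (y, x) \<in> X j else (j, i) \<in> I"
      using xy yx lex_sum_iff[OF d] ij by blast+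
    then show ?thesis using I X[OF ij(1)] unfolding Partial_order_iff by metis
  qed
  ultimately show ?thesis unfolding Partial_order_iff by blast
qed

section \<open>The Feferman-Vaught argument\<close>

text \<open>
  The values of variables outside \<open>V i\<close> are never inspected in the summand \<open>i\<close>, so that valuations
  may be arbitrary there and empty summands do no harm.
\<close>

definition summandwise_equiv ::
  "'i rel \<Rightarrow> ('i \<Rightarrow> 'b rel) \<Rightarrow> ('i \<Rightarrow> 'c rel) \<Rightarrow> fm set \<Rightarrow> ('i \<Rightarrow> nat set) \<Rightarrow>
     (nat \<Rightarrow> 'b) \<Rightarrow> (nat \<Rightarrow> 'c) \<Rightarrow> bool" where
  "summandwise_equiv I X Y \<Phi> V e f \<longleftrightarrow>
     (\<forall>i\<in>Field I. e ` V i \<subseteq> Field (X i) \<and> f ` V i \<subseteq> Field (Y i) \<and>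
        (\<forall>\<psi>\<in>\<Phi>. fvars \<psi> \<subseteq> V i \<longrightarrow> sat (X i) e \<psi> = sat (Y i) f \<psi>))"

lemma summandwise_equiv_sym:
  "summandwise_equiv I X Y \<Phi> V e f \<Longrightarrow> summandwise_equiv I Y X \<Phi> V f e"
  by (auto simp: summandwise_equiv_def)

lemma summandwise_equiv_mono:
  "summandwise_equiv I X Y \<Phi> V e f \<Longrightarrow> \<Psi> \<subseteq> \<Phi> \<Longrightarrow> summandwise_equiv I X Y \<Psi> V e f"
  unfolding summandwise_equiv_def by blast

text \<open>Agreement on these formulas allows a witness for \<open>n\<close> in one sum to be
  matched in the other: \<open>W\<close> will collect the members of \<Phi> that speak about the
  summand of the witness, \<open>S\<close> those of them that the witness makes true.\<close>

definition existential_patterns :: "nat \<Rightarrow> fm set \<Rightarrow> fm set" where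
  "existential_patterns n \<Phi> = (\<lambda>(W, S). Exists n (truth_pattern W S)) ` (Pow \<Phi> \<times> Pow \<Phi>)"

text \<open>Only the summand containing the witness \<open>x\<close> is affected. The truth values
  that \<open>x\<close> produces there are described by one existential formula, which transfers,
  and any \<open>y\<close> realizing it is a witness. The other direction will follow from the
  symmetry of \<open>summandwise_equiv\<close>.\<close>

lemma summandwise_equiv_Exists:
  assumes IH: "\<And>V e f. \<lbrakk>summandwise_equiv I X Y \<Phi> V e f; fvars \<phi> \<subseteq> (\<Union>i\<in>Field I. V i)\<rbrakk> \<Longrightarrow>
      sat (lex_sum I X) e \<phi> \<Longrightarrow> sat (lex_sum I Y) f \<phi>"
    and \<Phi>: "finite \<Phi>"
    and eq: "summandwise_equiv I X Y (\<Phi> \<union> existential_patterns n \<Phi>) V e f"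
    and V: "fvars (Exists n \<phi>) \<subseteq> (\<Union>i\<in>Field I. V i)"
    and sat: "sat (lex_sum I X) e (Exists n \<phi>)"
  shows "sat (lex_sum I Y) f (Exists n \<phi>)"
proof -
  have eqF: "e ` V j \<subseteq> Field (X j)" "f ` V j \<subseteq> Field (Y j)"
    and eqsat: "\<And>\<psi>. \<psi> \<in> \<Phi> \<union> existential_patterns n \<Phi> \<Longrightarrow> fvars \<psi> \<subseteq> V j \<Longrightarrow>
      sat (X j) e \<psi> = sat (Y j) f \<psi>" if "j \<in> Field I" for j
    using eq that unfolding summandwise_equiv_def by blast+
  obtain x where "x \<in> Field (lex_sum I X)" and x\<phi>: "sat (lex_sum I X) (e(n := x)) \<phi>"
    using sat by auto
  then obtain i where i: "i \<in> Field I" "x \<in> Field (X i)" by (auto simp: Field_lex_sum)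
  \<comment> \<open>Formulas with a variable assigned to another summand are left out, since
    agreement in the summand \<open>i\<close> does not cover them.\<close>
  define W where "W = {\<psi> \<in> \<Phi>. fvars \<psi> \<subseteq> insert n (V i)}"
  define S where "S = {\<psi> \<in> W. sat (X i) (e(n := x)) \<psi>}"
  let ?\<chi> = "Exists n (truth_pattern W S)"
  have W: "finite W" using \<Phi> by (simp add: W_def)
  have "?\<chi> \<in> existential_patterns n \<Phi>"
    by (auto simp: existential_patterns_def W_def S_def)
  moreover have "fvars ?\<chi> \<subseteq> V i"
    unfolding fvars.simps fvars_truth_pattern[OF W] by (auto simp: W_def)
  ultimately have "sat (X i) e ?\<chi> = sat (Y i) f ?\<chi>"
    using eqsat[OF i(1)] by blast
  moreover have "sat (X i) e ?\<chi>"
    using i(2) by (auto simp: sat_truth_pattern[OF W] S_def)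
  ultimately obtain y where y: "y \<in> Field (Y i)"
    "\<And>\<psi>. \<psi> \<in> W \<Longrightarrow> sat (X i) (e(n := x)) \<psi> = sat (Y i) (f(n := y)) \<psi>"
    by (auto simp: sat_truth_pattern[OF W] S_def)
  \<comment> \<open>The old value of \<open>n\<close> may have belonged to another summand;
    rebinding moves \<open>n\<close> to \<open>i\<close>.\<close>
  define V' where "V' j = (if j = i then insert n (V i) else V j - {n})" for j
  have "summandwise_equiv I X Y \<Phi> V' (e(n := x)) (f(n := y))"
    unfolding summandwise_equiv_def
  proof (intro ballI conjI impI)
    fix j assume j: "j \<in> Field I"
    show "(e(n := x)) ` V' j \<subseteq> Field (X j)" "(f(n := y)) ` V' j \<subseteq> Field (Y j)"
      using eqF[OF j] i(2) y(1) unfolding V'_def by auto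
    fix \<psi> assume \<psi>: "\<psi> \<in> \<Phi>" "fvars \<psi> \<subseteq> V' j"
    show "sat (X j) (e(n := x)) \<psi> = sat (Y j) (f(n := y)) \<psi>"
    proof (cases "j = i")
      case True
      then show ?thesis using y(2)[of \<psi>] \<psi> by (auto simp: W_def V'_def)
    next
      case False
      then have n: "n \<notin> fvars \<psi>" and "fvars \<psi> \<subseteq> V j" using \<psi>(2) by (auto simp: V'_def)
      then have "sat (X j) e \<psi> = sat (Y j) f \<psi>"
        using eqsat[OF j] \<psi>(1) by blast
      moreover have "sat (X j) (e(n := x)) \<psi> = sat (X j) e \<psi>"
        "sat (Y j) (f(n := y)) \<psi> = sat (Y j) f \<psi>"
        by (rule sat_cong; use n in auto)+
      ultimately show ?thesis by simp
    qed
  qed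
  moreover have "fvars \<phi> \<subseteq> (\<Union>j\<in>Field I. V' j)"
    using V i(1) by (force simp: V'_def)
  ultimately have "sat (lex_sum I Y) (f(n := y)) \<phi>" using IH x\<phi> by blast
  then show ?thesis using y(1) i(1) by (auto simp: Field_lex_sum)
qed

text \<open>\<Phi> is chosen before \<open>V\<close>, \<open>e\<close> and \<open>f\<close>: the
  quantifier step assigns a variable to another summand, and the same \<Phi> has to serve the new
  distribution. Each quantifier adds the existential patterns over the previous set.\<close>

lemma lex_sum_Feferman_Vaught:
  assumes X: "disjoint_summands I X" and Y: "disjoint_summands I Y"
  shows "\<exists>\<Phi>. finite \<Phi> \<and>
    (\<forall>V e f. summandwise_equiv I X Y \<Phi> V e f \<longrightarrow> fvars \<phi> \<subseteq> (\<Union>i\<in>Field I. V i) \<longrightarrow>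
       sat (lex_sum I X) e \<phi> = sat (lex_sum I Y) f \<phi>)"
proof (induction \<phi>)
  case (Leq m n)
  have "sat (lex_sum I X) e (Leq m n) = sat (lex_sum I Y) f (Leq m n)"
    if eq: "summandwise_equiv I X Y {Leq m n} V e f" and V: "fvars (Leq m n) \<subseteq> (\<Union>i\<in>Field I. V i)"
    for V e f
  proof -
    obtain i j where ij: "i \<in> Field I" "m \<in> V i" "j \<in> Field I" "n \<in> V j" using V by auto
    then have F: "e m \<in> Field (X i)" "e n \<in> Field (X j)" "f m \<in> Field (Y i)" "f n \<in> Field (Y j)"
      using eq by (auto simp: summandwise_equiv_def)
    have "(e m, e n) \<in> X i \<longleftrightarrow> (f m, f n) \<in> Y i" if "i = j"
      using eq ij that by (auto simp: summandwise_equiv_def)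
    then show ?thesis
      using lex_sum_iff[OF X ij(1,3) F(1,2)] lex_sum_iff[OF Y ij(1,3) F(3,4)] by auto
  qed
  then show ?case by blast
next
  case (Equal m n)
  have "sat (lex_sum I X) e (Equal m n) = sat (lex_sum I Y) f (Equal m n)"
    if eq: "summandwise_equiv I X Y {Equal m n} V e f"
      and V: "fvars (Equal m n) \<subseteq> (\<Union>i\<in>Field I. V i)"
    for V e f
  proof -
    obtain i j where ij: "i \<in> Field I" "m \<in> V i" "j \<in> Field I" "n \<in> V j" using V by auto
    then have F: "e m \<in> Field (X i)" "e n \<in> Field (X j)" "f m \<in> Field (Y i)" "f n \<in> Field (Y j)"
      using eq by (auto simp: summandwise_equiv_def)
    show ?thesis
    proof (cases "i = j")
      case True
      then show ?thesis using eq ij by (auto simp: summandwise_equiv_def)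
    next
      case False
      then have "e m \<noteq> e n" "f m \<noteq> f n"
        using disjoint_summandsD[OF X ij(1,3)] disjoint_summandsD[OF Y ij(1,3)] F by metis+
      then show ?thesis by simp
    qed
  qed
  then show ?case by blast
next
  case (Neg \<phi>)
  then show ?case by auto
next
  case (Conj \<phi> \<psi>)
  obtain \<Phi> where \<Phi>: "finite \<Phi>" "\<And>V e f. summandwise_equiv I X Y \<Phi> V e f \<Longrightarrow>
      fvars \<phi> \<subseteq> (\<Union>i\<in>Field I. V i) \<Longrightarrow> sat (lex_sum I X) e \<phi> = sat (lex_sum I Y) f \<phi>"
    using Conj.IH(1) by blast
  obtain \<Psi> where \<Psi>: "finite \<Psi>" "\<And>V e f. summandwise_equiv I X Y \<Psi> V e f \<Longrightarrow>
      fvars \<psi> \<subseteq> (\<Union>i\<in>Field I. V i) \<Longrightarrow> sat (lex_sum I X) e \<psi> = sat (lex_sum I Y) f \<psi>"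
    using Conj.IH(2) by blast
  have "finite (\<Phi> \<union> \<Psi>)" using \<Phi>(1) \<Psi>(1) by simp
  moreover have "sat (lex_sum I X) e (Conj \<phi> \<psi>) = sat (lex_sum I Y) f (Conj \<phi> \<psi>)"
    if eq: "summandwise_equiv I X Y (\<Phi> \<union> \<Psi>) V e f"
      and V: "fvars (Conj \<phi> \<psi>) \<subseteq> (\<Union>i\<in>Field I. V i)" for V e f
    using \<Phi>(2)[OF summandwise_equiv_mono[OF eq]] \<Psi>(2)[OF summandwise_equiv_mono[OF eq]] V by simp
  ultimately show ?case by blast
next
  case (Exists n \<phi>)
  then obtain \<Phi> where \<Phi>: "finite \<Phi>"
    and IH: "\<And>V e f. summandwise_equiv I X Y \<Phi> V e f \<Longrightarrow> fvars \<phi> \<subseteq> (\<Union>i\<in>Field I. V i) \<Longrightarrow>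
        sat (lex_sum I X) e \<phi> = sat (lex_sum I Y) f \<phi>"
    by blast
  have "finite (\<Phi> \<union> existential_patterns n \<Phi>)"
    using \<Phi> by (simp add: existential_patterns_def)
  moreover have "sat (lex_sum I X) e (Exists n \<phi>) = sat (lex_sum I Y) f (Exists n \<phi>)"
    if eq: "summandwise_equiv I X Y (\<Phi> \<union> existential_patterns n \<Phi>) V e f"
      and V: "fvars (Exists n \<phi>) \<subseteq> (\<Union>i\<in>Field I. V i)" for V e f
  proof
    show "sat (lex_sum I Y) f (Exists n \<phi>)" if "sat (lex_sum I X) e (Exists n \<phi>)"
      by (rule summandwise_equiv_Exists[OF _ \<Phi> eq V that]) (use IH in blast)
    show "sat (lex_sum I X) e (Exists n \<phi>)" if "sat (lex_sum I Y) f (Exists n \<phi>)"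
      by (rule summandwise_equiv_Exists[OF _ \<Phi> summandwise_equiv_sym[OF eq] V that])
        (use IH summandwise_equiv_sym in blast)
  qed
  ultimately show ?case by blast
qed

text \<open>For a sentence no variable has to be assigned to a summand, and summandwise agreement
  reduces to equality of the theories.\<close>

lemma Th_lex_sum:
  assumes X: "disjoint_summands I X" and Y: "disjoint_summands I Y"
    and Th: "\<And>i. i \<in> Field I \<Longrightarrow> Th (X i) = Th (Y i)"
  shows "Th (lex_sum I X) = Th (lex_sum I Y)"
  unfolding Th_eq_iff
proof (intro allI impI)
  fix \<phi> e f
  assume \<phi>: "fvars \<phi> = {}"
  have "summandwise_equiv I X Y \<Phi> (\<lambda>_. {}) e f" for \<Phi>
    using Th unfolding summandwise_equiv_def Th_eq_iff by auto
  then show "sat (lex_sum I X) e \<phi> = sat (lex_sum I Y) f \<phi>"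
    using lex_sum_Feferman_Vaught[OF X Y, of \<phi>] \<phi> by blast
qed


section \<open>Generic models\<close>

text \<open>
  Henkin's construction inside the theory of a fixed structure \<open>r\<close>: a condition is a formula
  satisfiable in \<open>r\<close>, its free variables serve as the Henkin constants, and \<open>R\<close> lists the
  requirements to be met.  Completeness of the theory of \<open>r\<close> replaces a proof calculus.
\<close>

locale generic =
  fixes r :: "'a rel" and consistent :: "fm \<Rightarrow> bool" and R :: "nat \<Rightarrow> fm set"
  assumes po: "Partial_order r"
    and consistent_sat: "\<And>\<phi>. consistent \<phi> \<Longrightarrow> \<exists>e. range e \<subseteq> Field r \<and> sat r e \<phi>"
    and consistent_Verum: "consistent Verum"
    and dense: "\<And>\<phi> k. consistent \<phi> \<Longrightarrow> \<exists>\<chi>\<in>R k. consistent (Conj \<phi> \<chi>)"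
    and decide: "\<And>\<psi>. \<exists>k. R k = {\<psi>, Neg \<psi>}"
    and witness: "\<And>n \<psi>. \<exists>k. R k = insert (Neg (Exists n \<psi>)) (range (\<lambda>c. ren \<psi> (id(n := c))))"
begin

primrec stage :: "nat \<Rightarrow> fm" where
  "stage 0 = Verum"
| "stage (Suc k) = Conj (stage k) (SOME \<chi>. \<chi> \<in> R k \<and> consistent (Conj (stage k) \<chi>))"

lemma stage_Suc: "consistent (stage k) \<Longrightarrow> \<exists>\<chi>\<in>R k. stage (Suc k) = Conj (stage k) \<chi> \<and> consistent (Conj (stage k) \<chi>)"
proof -
  assume "consistent (stage k)"
  then have "\<exists>\<chi>. \<chi> \<in> R k \<and> consistent (Conj (stage k) \<chi>)" using dense by blast
  from someI_ex[OF this] show ?thesis by auto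
qed

lemma consistent_stage: "consistent (stage k)"
proof (induction k)
  case (Suc k)
  then show ?case using stage_Suc[OF Suc] by auto
qed (simp add: consistent_Verum)

lemma stage_mono: "k \<le> l \<Longrightarrow> sat r e (stage l) \<Longrightarrow> sat r e (stage k)"
  by (induction l rule: dec_induct) auto

text \<open>The filter generated by the stages, with consequence read as truth in \<open>r\<close>
  under valuations into its field. It is a complete Henkin theory whose constants are the
  variables.\<close>

definition G :: "fm set" where
  "G = {\<chi>. \<exists>k. \<forall>e. range e \<subseteq> Field r \<longrightarrow> sat r e (stage k) \<longrightarrow> sat r e \<chi>}"

lemma G_meets: "\<exists>\<chi>\<in>R k. \<chi> \<in> G"
proof -
  obtain \<chi> where \<chi>: "\<chi> \<in> R k" "stage (Suc k) = Conj (stage k) \<chi>"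
    using stage_Suc[OF consistent_stage] by blast
  then have "\<chi> \<in> G" unfolding G_def mem_Collect_eq by (intro exI[of _ "Suc k"]) simp
  then show ?thesis using \<chi>(1) by blast
qed

lemma G_finite_sat:
  assumes "finite \<Phi>" "\<Phi> \<subseteq> G"
  shows "\<exists>e. range e \<subseteq> Field r \<and> (\<forall>\<phi>\<in>\<Phi>. sat r e \<phi>)"
proof -
  have "\<exists>k. \<forall>e. range e \<subseteq> Field r \<longrightarrow> sat r e (stage k) \<longrightarrow> (\<forall>\<phi>\<in>\<Phi>. sat r e \<phi>)"
    using assms
  proof (induction \<Phi>)
    case (insert \<chi> \<Phi>)
    then obtain k where k: "\<And>e. range e \<subseteq> Field r \<Longrightarrow> sat r e (stage k) \<Longrightarrow> \<forall>\<phi>\<in>\<Phi>. sat r e \<phi>"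
      by auto
    obtain l where l: "\<And>e. range e \<subseteq> Field r \<Longrightarrow> sat r e (stage l) \<Longrightarrow> sat r e \<chi>"
      using insert.prems by (auto simp: G_def)
    have "\<forall>\<phi>\<in>insert \<chi> \<Phi>. sat r e \<phi>"
      if "range e \<subseteq> Field r" "sat r e (stage (max k l))" for e
      using k[OF that(1)] l[OF that(1)] stage_mono[OF _ that(2)] by auto
    then show ?case by blast
  qed simp
  then obtain k where k: "\<forall>e. range e \<subseteq> Field r \<longrightarrow> sat r e (stage k) \<longrightarrow> (\<forall>\<phi>\<in>\<Phi>. sat r e \<phi>)" ..
  obtain e where "range e \<subseteq> Field r" "sat r e (stage k)"
    using consistent_sat[OF consistent_stage[of k]] by blast
  then show ?thesis using k by (intro exI[of _ e]) simp
qed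

text \<open>Otherwise completeness of \<open>G\<close> supplies \<open>Neg \<chi>\<close>, and a
  finite part of \<open>G\<close> would be unsatisfiable in \<open>r\<close>.\<close>

lemma G_closed:
  assumes "finite \<Phi>" "\<Phi> \<subseteq> G"
    and imp: "\<And>e. range e \<subseteq> Field r \<Longrightarrow> \<forall>\<phi>\<in>\<Phi>. sat r e \<phi> \<Longrightarrow> sat r e \<chi>"
  shows "\<chi> \<in> G"
proof (rule ccontr)
  assume \<chi>: "\<chi> \<notin> G"
  obtain k where "R k = {\<chi>, Neg \<chi>}" using decide by blast
  then have "Neg \<chi> \<in> G" using G_meets[of k] \<chi> by auto
  then show False using G_finite_sat[of "insert (Neg \<chi>) \<Phi>"] assms(1,2) imp by auto
qed

lemma G_imp:
  assumes "\<phi> \<in> G" and "\<And>e. range e \<subseteq> Field r \<Longrightarrow> sat r e \<phi> \<Longrightarrow> sat r e \<chi>"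
  shows "\<chi> \<in> G"
  by (rule G_closed[of "{\<phi>}"]) (use assms in auto)

lemma G_valid:
  assumes "\<And>e. range e \<subseteq> Field r \<Longrightarrow> sat r e \<chi>"
  shows "\<chi> \<in> G"
  by (rule G_closed[of "{}"]) (use assms in auto)

lemma G_Neg: "Neg \<phi> \<in> G \<longleftrightarrow> \<phi> \<notin> G"
proof
  assume Neg: "Neg \<phi> \<in> G"
  show "\<phi> \<notin> G"
  proof
    assume "\<phi> \<in> G"
    then have "{\<phi>, Neg \<phi>} \<subseteq> G" using Neg by simp
    then show False using G_finite_sat[of "{\<phi>, Neg \<phi>}"] by auto
  qed
next
  assume "\<phi> \<notin> G"
  moreover obtain k where "R k = {\<phi>, Neg \<phi>}" using decide by blast
  ultimately show "Neg \<phi> \<in> G" using G_meets[of k] by auto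
qed

lemma G_Conj: "Conj \<phi> \<psi> \<in> G \<longleftrightarrow> \<phi> \<in> G \<and> \<psi> \<in> G"
proof
  assume "Conj \<phi> \<psi> \<in> G"
  then show "\<phi> \<in> G \<and> \<psi> \<in> G" using G_imp[of "Conj \<phi> \<psi>"] by simp
next
  assume "\<phi> \<in> G \<and> \<psi> \<in> G"
  then show "Conj \<phi> \<psi> \<in> G" by (intro G_closed[of "{\<phi>, \<psi>}"]) auto
qed

lemma G_Exists:
  "ren (Exists n \<psi>) \<sigma> \<in> G \<longleftrightarrow> (\<exists>d. ren \<psi> (\<sigma>(n := d)) \<in> G)"
proof
  assume ex: "ren (Exists n \<psi>) \<sigma> \<in> G"
  obtain c where c: "c \<notin> \<sigma> ` (fvars \<psi> - {n})"
    and eq: "ren (Exists n \<psi>) \<sigma> = Exists c (ren \<psi> (\<sigma>(n := c)))"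
    by (rule ren_Exists)
  let ?\<psi> = "ren \<psi> (\<sigma>(n := c))"
  obtain k where "R k = insert (Neg (Exists c ?\<psi>)) (range (\<lambda>d. ren ?\<psi> (id(c := d))))"
    using witness by blast
  moreover have "Neg (Exists c ?\<psi>) \<notin> G" using ex eq G_Neg by simp
  ultimately obtain d where d: "ren ?\<psi> (id(c := d)) \<in> G" using G_meets[of k] by auto
  \<comment> \<open>The bound variable \<open>c\<close> was chosen fresh, so renaming first to
    \<open>c\<close> and then to \<open>d\<close> amounts to renaming directly to
    \<open>d\<close>.\<close>
  have "sat r e (ren ?\<psi> (id(c := d))) = sat r e (ren \<psi> (\<sigma>(n := d)))" for e
    unfolding sat_ren by (rule sat_cong) (use c in auto)
  then have "ren \<psi> (\<sigma>(n := d)) \<in> G" using G_imp[OF d] by blast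
  then show "\<exists>d. ren \<psi> (\<sigma>(n := d)) \<in> G" by blast
next
  assume "\<exists>d. ren \<psi> (\<sigma>(n := d)) \<in> G"
  then obtain d where d: "ren \<psi> (\<sigma>(n := d)) \<in> G" by blast
  show "ren (Exists n \<psi>) \<sigma> \<in> G"
  proof (rule G_imp[OF d])
    fix e :: "nat \<Rightarrow> 'a"
    assume e: "range e \<subseteq> Field r" "sat r e (ren \<psi> (\<sigma>(n := d)))"
    have "e \<circ> \<sigma>(n := d) = (e \<circ> \<sigma>)(n := e d)" by auto
    then have "sat r ((e \<circ> \<sigma>)(n := e d)) \<psi>" using e(2) unfolding sat_ren by simp
    then show "sat r e (ren (Exists n \<psi>) \<sigma>)" unfolding sat_ren using e(1) by auto
  qed
qed

text \<open>Taking the least variable equal to \<open>m\<close> as representative keeps the quotient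
  by equality on a subset of \<open>nat\<close>.\<close>

definition cls :: "nat \<Rightarrow> nat" where
  "cls m = (LEAST k. Equal m k \<in> G)"

definition M :: "nat rel" where
  "M = {(cls m, cls n) | m n. Leq m n \<in> G}"

lemma Equal_refl: "Equal m m \<in> G"
  by (rule G_valid) simp

lemma Equal_cls: "Equal m (cls m) \<in> G"
  unfolding cls_def by (rule LeastI[of _ m]) (rule Equal_refl)

lemma cls_eq_iff: "cls m = cls n \<longleftrightarrow> Equal m n \<in> G"
proof
  assume "cls m = cls n"
  then show "Equal m n \<in> G"
    using Equal_cls[of m] Equal_cls[of n]
    by (intro G_closed[of "{Equal m (cls m), Equal n (cls m)}"]) auto
next
  assume mn: "Equal m n \<in> G"
  have "Equal m k \<in> G \<longleftrightarrow> Equal n k \<in> G" for k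
  proof
    show "Equal n k \<in> G" if "Equal m k \<in> G"
      using mn that by (intro G_closed[of "{Equal m n, Equal m k}"]) auto
    show "Equal m k \<in> G" if "Equal n k \<in> G"
      using mn that by (intro G_closed[of "{Equal m n, Equal n k}"]) auto
  qed
  then show "cls m = cls n" by (simp add: cls_def)
qed

lemma M_iff: "(cls m, cls n) \<in> M \<longleftrightarrow> Leq m n \<in> G"
proof
  assume "(cls m, cls n) \<in> M"
  then obtain m' n' where "cls m = cls m'" "cls n = cls n'" "Leq m' n' \<in> G"
    by (auto simp: M_def)
  then show "Leq m n \<in> G"
    by (intro G_closed[of "{Equal m m', Equal n n', Leq m' n'}"]) (auto simp: cls_eq_iff)
qed (auto simp: M_def)

lemma Field_M: "Field M = range cls"
proof
  show "range cls \<subseteq> Field M"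
  proof clarify
    fix m
    have "Leq m m \<in> G"
      by (rule G_valid) (use po in \<open>auto simp: Partial_order_iff image_subset_iff\<close>)
    then have "(cls m, cls m) \<in> M" by (simp add: M_iff)
    then show "cls m \<in> Field M" by (rule FieldI1)
  qed
qed (auto simp: M_def Field_def)

text \<open>The truth lemma. It is stated for arbitrary \<sigma> because the quantifier step changes
  the valuation; every element of the domain is the class of a variable, so witnesses correspond to
  renamings.\<close>

lemma sat_M: "sat M (cls \<circ> \<sigma>) \<phi> \<longleftrightarrow> ren \<phi> \<sigma> \<in> G"
proof (induction \<phi> arbitrary: \<sigma>)
  case (Exists n \<phi>)
  have *: "(cls \<circ> \<sigma>)(n := cls d) = cls \<circ> \<sigma>(n := d)" for d by auto
  have "sat M (cls \<circ> \<sigma>) (Exists n \<phi>) \<longleftrightarrow> (\<exists>d. sat M (cls \<circ> \<sigma>(n := d)) \<phi>)"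
    unfolding sat.simps Field_M by (simp add: * del: fun_upd_apply)
  then show ?case by (simp only: Exists.IH G_Exists)
qed (simp_all add: M_iff cls_eq_iff G_Neg G_Conj del: ren.simps(5))

lemma sat_M_cls: "sat M cls \<phi> \<longleftrightarrow> \<phi> \<in> G"
proof -
  \<comment> \<open>\<open>ren\<close> may change bound variables even along the identity, so the
    two formulas are only equivalent.\<close>
  have "ren \<phi> id \<in> G \<longleftrightarrow> \<phi> \<in> G"
    using G_imp[of "ren \<phi> id" \<phi>] G_imp[of \<phi> "ren \<phi> id"] by (auto simp: sat_ren)
  then show ?thesis using sat_M[of id \<phi>] by simp
qed

lemma Th_M: "Th M = Th r"
proof -
  have "sat M cls \<phi>" if "\<phi> \<in> Th r" for \<phi>
    unfolding sat_M_cls by (rule G_valid) (use that in \<open>simp add: Th_def\<close>)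
  then have "models M (Th r)"
    unfolding models_def Th_def using sat_sentence by blast
  then show ?thesis by (simp add: models_Th_iff)
qed

lemma Partial_order_M: "Partial_order M"
proof -
  have po': "\<And>x. x \<in> Field r \<Longrightarrow> (x, x) \<in> r"
    "\<And>x y z. (x, y) \<in> r \<Longrightarrow> (y, z) \<in> r \<Longrightarrow> (x, z) \<in> r"
    "\<And>x y. (x, y) \<in> r \<Longrightarrow> (y, x) \<in> r \<Longrightarrow> x = y"
    using po unfolding Partial_order_iff by blast+
  have 1: "(cls l, cls l) \<in> M" for l
    unfolding M_iff by (rule G_valid) (use po'(1) in auto)
  have 2: "(cls l, cls n) \<in> M" if "(cls l, cls m) \<in> M" "(cls m, cls n) \<in> M" for l m n
    using that unfolding M_iff
    by (intro G_closed[of "{Leq l m, Leq m n}" "Leq l n"]) (simp_all, blast intro: po'(2))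
  have 3: "cls l = cls m" if "(cls l, cls m) \<in> M" "(cls m, cls l) \<in> M" for l m
    using that unfolding M_iff cls_eq_iff
    by (intro G_closed[of "{Leq l m, Leq m l}" "Equal l m"]) (simp_all, blast intro: po'(3))
  have F: "\<exists>m n. x = cls m \<and> y = cls n" if "(x, y) \<in> M" for x y using that by (auto simp: M_def)
  show ?thesis unfolding Partial_order_iff
  proof (intro conjI allI impI ballI)
    show "(x, x) \<in> M" if "x \<in> Field M" for x using that 1 by (auto simp: Field_M)
    show "(x, z) \<in> M" if "(x, y) \<in> M" "(y, z) \<in> M" for x y z
      using F[OF that(1)] F[OF that(2)] 2 that by blast
    show "x = y" if "(x, y) \<in> M" "(y, x) \<in> M" for x y
      using F[OF that(1)] 3 that by blast
  qed
qed

end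

text \<open>Formulas are countable, so decisions, Henkin witnesses and \<R> together form a
  countable family that can be enumerated as the locale demands. Leaving \<open>consistent\<close>
  abstract lets conditions carry a type to be realized.\<close>

lemma generic_model:
  fixes r :: "'a rel" and \<R> :: "fm set set"
  assumes po: "Partial_order r"
    and sat: "\<And>\<phi>. consistent \<phi> \<Longrightarrow> \<exists>e. range e \<subseteq> Field r \<and> sat r e \<phi>"
    and Verum: "consistent Verum"
    and dec: "\<And>\<phi> \<psi>. consistent \<phi> \<Longrightarrow> consistent (Conj \<phi> \<psi>) \<or> consistent (Conj \<phi> (Neg \<psi>))"
    and wit: "\<And>\<phi> n \<psi>. consistent (Conj \<phi> (Exists n \<psi>)) \<Longrightarrow> \<exists>c. consistent (Conj \<phi> (ren \<psi> (id(n := c))))"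
    and \<R>: "countable \<R>"
    and dense: "\<And>\<phi> S. S \<in> \<R> \<Longrightarrow> consistent \<phi> \<Longrightarrow> \<exists>\<chi>\<in>S. consistent (Conj \<phi> \<chi>)"
  shows "\<exists>(M :: nat rel) g. Partial_order M \<and> Th M = Th r \<and> range g = Field M \<and>
    (\<forall>S\<in>\<R>. \<exists>\<chi>\<in>S. sat M g \<chi>)"
proof -
  define D where "D \<psi> = {\<psi>, Neg \<psi>}" for \<psi>
  define W where "W n \<psi> = insert (Neg (Exists n \<psi>)) (range (\<lambda>c. ren \<psi> (id(n := c))))" for n \<psi>
  define \<S> where "\<S> = range D \<union> range (\<lambda>(n, \<psi>). W n \<psi>) \<union> \<R>"
  have "countable \<S>" "\<S> \<noteq> {}" using \<R> by (auto simp: \<S>_def)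
  then have R: "range (from_nat_into \<S>) = \<S>" by (simp add: range_from_nat_into)
  have mem: "\<exists>k. from_nat_into \<S> k = S" if "S \<in> \<S>" for S
  proof -
    have "S \<in> range (from_nat_into \<S>)" using that by (simp add: R)
    then show ?thesis by auto
  qed
  interpret generic r consistent "from_nat_into \<S>"
  proof
    fix \<phi> k assume \<phi>: "consistent \<phi>"
    have "from_nat_into \<S> k \<in> \<S>" using \<open>\<S> \<noteq> {}\<close> by (rule from_nat_into)
    then have "(\<exists>\<psi>. from_nat_into \<S> k = D \<psi>) \<or> (\<exists>n \<psi>. from_nat_into \<S> k = W n \<psi>) \<or>
        from_nat_into \<S> k \<in> \<R>"
      unfolding \<S>_def by auto
    then show "\<exists>\<chi>\<in>from_nat_into \<S> k. consistent (Conj \<phi> \<chi>)"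
    proof (elim disjE exE)
      fix \<psi> assume "from_nat_into \<S> k = D \<psi>"
      then show ?thesis using dec[OF \<phi>, of \<psi>] by (simp add: D_def)
    next
      fix n \<psi> assume "from_nat_into \<S> k = W n \<psi>"
      then show ?thesis using dec[OF \<phi>, of "Exists n \<psi>"] wit[of \<phi> n \<psi>] by (auto simp: W_def)
    next
      assume "from_nat_into \<S> k \<in> \<R>"
      then show ?thesis using dense \<phi> by simp
    qed
  next
    fix \<psi>
    have "D \<psi> \<in> \<S>" by (simp add: \<S>_def)
    then show "\<exists>k. from_nat_into \<S> k = {\<psi>, Neg \<psi>}" using mem by (simp add: D_def)
  next
    fix n \<psi>
    have "W n \<psi> \<in> \<S>" by (auto simp: \<S>_def)
    then show "\<exists>k. from_nat_into \<S> k = insert (Neg (Exists n \<psi>)) (range (\<lambda>c. ren \<psi> (id(n := c))))"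
      using mem by (simp add: W_def)
  qed (use po sat Verum in auto)
  have "\<exists>\<chi>\<in>S. sat M cls \<chi>" if "S \<in> \<R>" for S
  proof -
    have "S \<in> \<S>" using that by (simp add: \<S>_def)
    then obtain k where "from_nat_into \<S> k = S" using mem by blast
    then show ?thesis using G_meets[of k] by (simp add: sat_M_cls)
  qed
  then show ?thesis
    using Partial_order_M Th_M Field_M by (intro exI[of _ M] exI[of _ cls]) simp
qed


section \<open>The Ryll-Nardzewski theorem\<close>

definition jointly_sat :: "'a rel \<Rightarrow> fm set \<Rightarrow> fm \<Rightarrow> bool" where
  "jointly_sat r \<Delta> \<phi> \<longleftrightarrow>
     (\<forall>F. finite F \<longrightarrow> F \<subseteq> \<Delta> \<longrightarrow>
        (\<exists>e. range e \<subseteq> Field r \<and> sat r e \<phi> \<and> (\<forall>\<psi>\<in>F. sat r e \<psi>)))"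

lemma jointly_satD:
  "jointly_sat r \<Delta> \<phi> \<Longrightarrow> finite F \<Longrightarrow> F \<subseteq> \<Delta> \<Longrightarrow>
     \<exists>e. range e \<subseteq> Field r \<and> sat r e \<phi> \<and> (\<forall>\<psi>\<in>F. sat r e \<psi>)"
  by (simp add: jointly_sat_def)

text \<open>Finite satisfiability plays the role of consistency. Every member of \<Delta> can then
  be imposed as a singleton requirement, which gives compactness, while \<R> will express the
  avoidance of types.\<close>

lemma realize_and_omit:
  fixes r :: "'a rel"
  assumes po: "Partial_order r" and V: "finite V" "\<And>\<delta>. \<delta> \<in> \<Delta> \<Longrightarrow> fvars \<delta> \<subseteq> V"
    and Verum: "jointly_sat r \<Delta> Verum"
    and \<R>: "countable \<R>"
    and dense: "\<And>\<phi> S. S \<in> \<R> \<Longrightarrow> jointly_sat r \<Delta> \<phi> \<Longrightarrow> \<exists>\<chi>\<in>S. jointly_sat r \<Delta> (Conj \<phi> \<chi>)"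
  shows "\<exists>(M :: nat rel) g. Partial_order M \<and> Th M = Th r \<and> range g = Field M \<and>
    (\<forall>\<delta>\<in>\<Delta>. sat M g \<delta>) \<and> (\<forall>S\<in>\<R>. \<exists>\<chi>\<in>S. sat M g \<chi>)"
proof -
  have countable: "countable ((\<lambda>\<delta>. {\<delta>}) ` \<Delta> \<union> \<R>)" using \<R> by simp
  have sat: "\<exists>e. range e \<subseteq> Field r \<and> sat r e \<phi>" if "jointly_sat r \<Delta> \<phi>" for \<phi>
    using jointly_satD[OF that, of "{}"] by simp
  have decide: "jointly_sat r \<Delta> (Conj \<phi> \<psi>) \<or> jointly_sat r \<Delta> (Conj \<phi> (Neg \<psi>))"
    if \<phi>: "jointly_sat r \<Delta> \<phi>" for \<phi> \<psi>
  proof (rule ccontr)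
    assume neg: "\<not> ?thesis"
    obtain F where F: "finite F" "F \<subseteq> \<Delta>"
      "\<not> (\<exists>e. range e \<subseteq> Field r \<and> sat r e (Conj \<phi> \<psi>) \<and> (\<forall>\<psi>\<in>F. sat r e \<psi>))"
      using neg by (auto simp: jointly_sat_def)
    obtain F' where F': "finite F'" "F' \<subseteq> \<Delta>"
      "\<not> (\<exists>e. range e \<subseteq> Field r \<and> sat r e (Conj \<phi> (Neg \<psi>)) \<and> (\<forall>\<psi>\<in>F'. sat r e \<psi>))"
      using neg by (auto simp: jointly_sat_def)
    \<comment> \<open>A valuation satisfying both finite sets decides \<psi> one way and so
      contradicts one of the two refutations.\<close>
    obtain e where e: "range e \<subseteq> Field r" "sat r e \<phi>" "\<forall>\<psi>\<in>F \<union> F'. sat r e \<psi>"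
      using jointly_satD[OF \<phi>, of "F \<union> F'"] F(1,2) F'(1,2) by auto
    then have "\<not> sat r e \<psi>" "sat r e \<psi>" using F(3) F'(3) by auto
    then show False by simp
  qed
  have witness: "\<exists>c. jointly_sat r \<Delta> (Conj \<phi> (ren \<psi> (id(n := c))))"
    if sat: "jointly_sat r \<Delta> (Conj \<phi> (Exists n \<psi>))" for \<phi> n \<psi>
  proof -
    \<comment> \<open>All of \<Delta> uses only the finitely many variables in \<open>V\<close>,
      which leaves a fresh one to name the witness.\<close>
    have "finite (fvars \<phi> \<union> fvars \<psi> \<union> V)" using V(1) by simp
    then have "\<exists>c. c \<notin> fvars \<phi> \<union> fvars \<psi> \<union> V"
      by (rule ex_new_if_finite[OF infinite_UNIV_nat])
    then obtain c where c: "c \<notin> fvars \<phi> \<union> fvars \<psi> \<union> V" ..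
    have "jointly_sat r \<Delta> (Conj \<phi> (ren \<psi> (id(n := c))))"
      unfolding jointly_sat_def
    proof (intro allI impI)
      fix F assume F: "finite F" "F \<subseteq> \<Delta>"
      obtain e x where e: "range e \<subseteq> Field r" "sat r e \<phi>" "\<forall>\<psi>\<in>F. sat r e \<psi>"
        and x: "x \<in> Field r" "sat r (e(n := x)) \<psi>"
        using jointly_satD[OF sat F] by auto
      let ?e = "e(c := x)"
      have "range ?e \<subseteq> Field r" using e(1) x(1) by auto
      moreover have "sat r ?e \<phi> = sat r e \<phi>" by (rule sat_cong) (use c in auto)
      moreover have "sat r (?e \<circ> id(n := c)) \<psi> = sat r (e(n := x)) \<psi>"
        by (rule sat_cong) (use c in auto)
      moreover have "sat r ?e \<delta> = sat r e \<delta>" if "\<delta> \<in> F" for \<delta>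
        by (rule sat_cong) (use c V(2)[of \<delta>] F(2) that in auto)
      ultimately show "\<exists>e. range e \<subseteq> Field r \<and> sat r e (Conj \<phi> (ren \<psi> (id(n := c)))) \<and>
          (\<forall>\<psi>\<in>F. sat r e \<psi>)"
        using e x by (intro exI[of _ ?e]) (simp add: sat_ren)
    qed
    then show ?thesis ..
  qed
  have dense': "\<exists>\<chi>\<in>S. jointly_sat r \<Delta> (Conj \<phi> \<chi>)"
    if "S \<in> (\<lambda>\<delta>. {\<delta>}) ` \<Delta> \<union> \<R>" and \<phi>: "jointly_sat r \<Delta> \<phi>" for \<phi> S
    using that(1)
  proof
    assume "S \<in> \<R>"
    then show ?thesis using dense \<phi> by simp
  next
    assume "S \<in> (\<lambda>\<delta>. {\<delta>}) ` \<Delta>"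
    then obtain \<delta> where \<delta>: "\<delta> \<in> \<Delta>" "S = {\<delta>}" by blast
    have "jointly_sat r \<Delta> (Conj \<phi> \<delta>)"
      unfolding jointly_sat_def
    proof (intro allI impI)
      fix F assume "finite F" "F \<subseteq> \<Delta>"
      then show "\<exists>e. range e \<subseteq> Field r \<and> sat r e (Conj \<phi> \<delta>) \<and> (\<forall>\<psi>\<in>F. sat r e \<psi>)"
        using jointly_satD[OF \<phi>, of "insert \<delta> F"] \<delta>(1) by auto
    qed
    then show ?thesis using \<delta>(2) by simp
  qed
  have "\<exists>(M :: nat rel) g. Partial_order M \<and> Th M = Th r \<and> range g = Field M \<and>
      (\<forall>S\<in>(\<lambda>\<delta>. {\<delta>}) ` \<Delta> \<union> \<R>. \<exists>\<chi>\<in>S. sat M g \<chi>)"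
    by (rule generic_model[OF po sat Verum decide witness countable dense'])
  then show ?thesis by (simp add: ball_Un)
qed

section \<open>Types of tuples and their isolation\<close>

definition same_type :: "nat set \<Rightarrow> 'a rel \<Rightarrow> (nat \<Rightarrow> 'a) \<Rightarrow> 'b rel \<Rightarrow> (nat \<Rightarrow> 'b) \<Rightarrow> bool" where
  "same_type V r e s f \<longleftrightarrow> (\<forall>\<phi>. fvars \<phi> \<subseteq> V \<longrightarrow> sat r e \<phi> = sat s f \<phi>)"

lemma same_typeD: "same_type V r e s f \<Longrightarrow> fvars \<phi> \<subseteq> V \<Longrightarrow> sat r e \<phi> = sat s f \<phi>"
  by (simp add: same_type_def)

lemma same_type_sym: "same_type V r e s f \<Longrightarrow> same_type V s f r e"
  by (simp add: same_type_def)

lemma same_type_trans: "same_type V r e s f \<Longrightarrow> same_type V s f t g \<Longrightarrow> same_type V r e t g"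
  by (simp add: same_type_def)

lemma same_type_cong:
  assumes "\<And>v. v \<in> V \<Longrightarrow> e v = f v"
  shows "same_type V r e r f"
  unfolding same_type_def
proof (intro allI impI)
  fix \<phi> assume "fvars \<phi> \<subseteq> V"
  then show "sat r e \<phi> = sat r f \<phi>" by (intro sat_cong assms) blast
qed

lemma same_type_ord_iso:
  assumes "ord_iso h r s" and "e ` V \<subseteq> Field r"
  shows "same_type V r e s (h \<circ> e)"
  unfolding same_type_def
proof (intro allI impI)
  fix \<phi> assume "fvars \<phi> \<subseteq> V"
  then have "e ` fvars \<phi> \<subseteq> Field r" using assms(2) by auto
  then show "sat r e \<phi> = sat s (h \<circ> e) \<phi>" using sat_ord_iso[OF assms(1)] by blast
qed

text \<open>The tuples induced through \<sigma> by solutions of \<phi> form a definable set. Since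
  \<phi> and \<open>V\<close> may share names, the variables of \<phi> are shifted by
  \<open>N\<close>, beyond \<open>V\<close>, equated with the tuple and quantified away.\<close>

lemma definable_projection:
  assumes V: "finite V" and ne: "Field r \<noteq> {}"
  obtains \<psi> where "fvars \<psi> \<subseteq> V"
    and "\<And>b. b ` V \<subseteq> Field r \<Longrightarrow>
      sat r b \<psi> \<longleftrightarrow> (\<exists>e. range e \<subseteq> Field r \<and> sat r e \<phi> \<and> (\<forall>v\<in>V. e (\<sigma> v) = b v))"
proof -
  obtain x0 where x0: "x0 \<in> Field r" using ne by blast
  obtain N where N: "\<And>v. v \<in> V \<Longrightarrow> v < N"
    using V by (auto simp: finite_nat_set_iff_bounded)
  obtain vs where vs: "set vs = V" using finite_list[OF V] by blast
  define \<beta> where "\<beta> = Conj (ren \<phi> (\<lambda>v. v + N)) (Conjs (map (\<lambda>v. Equal v (\<sigma> v + N)) vs))"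
  have "finite (fvars \<beta> - V)" by simp
  then have "\<exists>ys. set ys = fvars \<beta> - V" by (rule finite_list)
  then obtain ys where ys: "set ys = fvars \<beta> - V" ..
  have sat\<beta>: "sat r e \<beta> \<longleftrightarrow> sat r (\<lambda>v. e (v + N)) \<phi> \<and> (\<forall>v\<in>V. e v = e (\<sigma> v + N))" for e
    by (simp add: \<beta>_def sat_ren vs comp_def)
  have ysI: "v + N \<in> set ys" if "v \<in> fvars \<phi> \<union> \<sigma> ` V" for v
    using that N[of "v + N"] unfolding ys \<beta>_def by (auto simp: fvars_ren vs)
  show thesis
  proof (rule that[of "Exs ys \<beta>"])
    show "fvars (Exs ys \<beta>) \<subseteq> V" using ys by auto
    fix b assume b: "b ` V \<subseteq> Field r"
    show "sat r b (Exs ys \<beta>) \<longleftrightarrow>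
      (\<exists>e. range e \<subseteq> Field r \<and> sat r e \<phi> \<and> (\<forall>v\<in>V. e (\<sigma> v) = b v))"
    proof
      assume "sat r b (Exs ys \<beta>)"
      then obtain f where f: "f ` set ys \<subseteq> Field r" "sat r (override_on b f (set ys)) \<beta>"
        unfolding sat_Exs by blast
      define e0 where "e0 = override_on b f (set ys)"
      \<comment> \<open>A total valuation into the field is required; \<open>x0\<close> fills the
        positions read neither by \<phi> nor through \<sigma>.\<close>
      define e where "e v = (if v \<in> fvars \<phi> \<union> \<sigma> ` V then e0 (v + N) else x0)" for v
      have "range e \<subseteq> Field r"
        using x0 f(1) ysI by (auto simp: e_def e0_def)
      moreover have "sat r e \<phi> = sat r (\<lambda>v. e0 (v + N)) \<phi>"
        by (rule sat_cong) (simp add: e_def)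
      moreover have "e (\<sigma> v) = b v" if "v \<in> V" for v
      proof -
        have "e (\<sigma> v) = e0 (\<sigma> v + N)" using that by (simp add: e_def)
        also have "\<dots> = e0 v" using f(2) that unfolding sat\<beta> e0_def by simp
        also have "\<dots> = b v" using that ys by (simp add: e0_def)
        finally show ?thesis .
      qed
      ultimately show "\<exists>e. range e \<subseteq> Field r \<and> sat r e \<phi> \<and> (\<forall>v\<in>V. e (\<sigma> v) = b v)"
        using f(2) unfolding sat\<beta> e0_def[symmetric] by (intro exI[of _ e]) simp
    next
      assume "\<exists>e. range e \<subseteq> Field r \<and> sat r e \<phi> \<and> (\<forall>v\<in>V. e (\<sigma> v) = b v)"
      then obtain e where e: "range e \<subseteq> Field r" "sat r e \<phi>" "\<forall>v\<in>V. e (\<sigma> v) = b v" by blast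
      define e0 where "e0 = override_on b (\<lambda>w. e (w - N)) (set ys)"
      have "sat r (\<lambda>v. e0 (v + N)) \<phi> = sat r e \<phi>"
        by (rule sat_cong) (use ysI in \<open>auto simp: e0_def\<close>)
      moreover have "e0 v = e0 (\<sigma> v + N)" if "v \<in> V" for v
        using that ysI[of "\<sigma> v"] ys e(3) by (auto simp: e0_def)
      ultimately have "sat r e0 \<beta>" using e(2) by (simp add: sat\<beta>)
      then show "sat r b (Exs ys \<beta>)"
        unfolding sat_Exs e0_def using e(1) by (intro exI[of _ "\<lambda>w. e (w - N)"]) auto
    qed
  qed
qed

text \<open>An unsatisfiable formula isolates vacuously; where a type is to be isolated,
  satisfaction by the tuple is asserted separately.\<close>

definition isolates :: "'a rel \<Rightarrow> nat set \<Rightarrow> fm \<Rightarrow> bool" where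
  "isolates r V \<phi> \<longleftrightarrow> fvars \<phi> \<subseteq> V \<and>
     (\<forall>a b. a ` V \<subseteq> Field r \<longrightarrow> b ` V \<subseteq> Field r \<longrightarrow> sat r a \<phi> \<longrightarrow> sat r b \<phi> \<longrightarrow> same_type V r a r b)"

definition categorical :: "'a rel \<Rightarrow> bool" where
  "categorical r \<longleftrightarrow> (\<forall>M :: nat rel. Partial_order M \<longrightarrow> Th M = Th r \<longrightarrow> ord_isomorphic r M)"

text \<open>A non-isolated type of \<open>a\<close> could be omitted in a countable model of the
  same theory. By categoricity this model is a copy of \<open>r\<close>, where the image of
  \<open>a\<close> realizes the type.\<close>

lemma categorical_atomic:
  fixes r :: "'a rel"
  assumes po: "Partial_order r" and cat: "categorical r" and ne: "Field r \<noteq> {}"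
    and V: "finite V" and a: "a ` V \<subseteq> Field r"
  shows "\<exists>\<phi>. isolates r V \<phi> \<and> sat r a \<phi>"
proof (rule ccontr)
  assume contr: "\<not> ?thesis"
  define p where "p = {\<theta>. fvars \<theta> \<subseteq> V \<and> sat r a \<theta>}"
  have p: "same_type V r b r a" if "\<And>\<theta>. \<theta> \<in> p \<Longrightarrow> sat r b \<theta>" for b
    unfolding same_type_def
  proof (intro allI impI)
    fix \<phi> assume "fvars \<phi> \<subseteq> V"
    then show "sat r b \<phi> = sat r a \<phi>"
      using that[of \<phi>] that[of "Neg \<phi>"] by (auto simp: p_def)
  qed
  \<comment> \<open>Tuples of Henkin constants are coded by lists, so that there are only countably
    many types to omit; the default 0 merely makes \<tau> total.\<close>
  define \<tau> where "\<tau> l v = (if v < length l then l ! v else 0)" for l :: "nat list" and v :: nat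
  define S where "S l = (\<lambda>\<theta>. Neg (ren \<theta> (\<tau> l))) ` p" for l
  have sat_iff: "jointly_sat r {} \<phi> \<longleftrightarrow> (\<exists>e. range e \<subseteq> Field r \<and> sat r e \<phi>)" for \<phi>
    by (auto simp: jointly_sat_def)
  have dense: "\<exists>\<chi>\<in>T. jointly_sat r {} (Conj \<phi> \<chi>)"
    if T: "T \<in> range S" and \<phi>: "jointly_sat r {} \<phi>" for \<phi> T
  proof (rule ccontr)
    obtain l where l: "T = S l" using T by blast
    \<comment> \<open>If \<phi> excludes every negation in the requirement, it forces all of
      \<open>p\<close> on the tuple named by \<open>l\<close>. Its projection to that tuple is then
      a formula isolating the type of \<open>a\<close>, against the assumption.\<close>
    assume "\<not> ?thesis"
    then have imp: "sat r (e \<circ> \<tau> l) \<theta>" if "\<theta> \<in> p" "range e \<subseteq> Field r" "sat r e \<phi>" for e \<theta>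
      using that unfolding sat_iff l S_def by (auto simp: sat_ren)
    obtain \<psi> where \<psi>: "fvars \<psi> \<subseteq> V" "\<And>b. b ` V \<subseteq> Field r \<Longrightarrow>
        sat r b \<psi> \<longleftrightarrow> (\<exists>e. range e \<subseteq> Field r \<and> sat r e \<phi> \<and> (\<forall>v\<in>V. e (\<tau> l v) = b v))"
      using definable_projection[OF V ne] by blast
    have type: "same_type V r b r a" if b: "b ` V \<subseteq> Field r" "sat r b \<psi>" for b
    proof (rule p)
      fix \<theta> assume \<theta>: "\<theta> \<in> p"
      obtain e where e: "range e \<subseteq> Field r" "sat r e \<phi>" "\<forall>v\<in>V. e (\<tau> l v) = b v"
        using \<psi>(2)[OF b(1)] b(2) by blast
      have "sat r (e \<circ> \<tau> l) \<theta> = sat r b \<theta>"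
        by (rule sat_cong) (use e(3) \<theta> in \<open>auto simp: p_def\<close>)
      then show "sat r b \<theta>" using imp[OF \<theta> e(1,2)] by simp
    qed
    obtain e where e: "range e \<subseteq> Field r" "sat r e \<phi>" using \<phi> unfolding sat_iff by blast
    let ?b = "e \<circ> \<tau> l"
    have b: "?b ` V \<subseteq> Field r" using e(1) by auto
    moreover have "sat r ?b \<psi>" unfolding \<psi>(2)[OF b] using e by (intro exI[of _ e]) simp
    ultimately have "sat r a \<psi>" using same_typeD[OF type \<psi>(1)] by blast
    moreover have "isolates r V \<psi>"
      unfolding isolates_def using \<psi>(1) by (blast intro: same_type_trans[OF type same_type_sym[OF type]])
    ultimately show False using contr by blast
  qed
  obtain x0 where "x0 \<in> Field r" using ne by blast
  then have Verum: "jointly_sat r {} Verum"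
    unfolding sat_iff by (intro exI[of _ "\<lambda>_. x0"]) auto
  have countable: "countable (range S)" by simp
  have "\<exists>(M :: nat rel) g. Partial_order M \<and> Th M = Th r \<and> range g = Field M \<and>
      (\<forall>\<delta>\<in>{}. sat M g \<delta>) \<and> (\<forall>T\<in>range S. \<exists>\<chi>\<in>T. sat M g \<chi>)"
    by (rule realize_and_omit[OF po V _ Verum countable dense]) simp
  then obtain M :: "nat rel" and g where M: "Partial_order M" "Th M = Th r" "range g = Field M"
    and met: "\<forall>T\<in>range S. \<exists>\<chi>\<in>T. sat M g \<chi>"
    by (elim exE conjE) (rule that)
  obtain h where h: "ord_iso h r M"
    using cat M(1,2) by (auto simp: categorical_def ord_isomorphic_iff)
  \<comment> \<open>Every element of \<open>M\<close> is named by a variable, so the image of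
    \<open>a\<close> is the tuple of one of the lists.\<close>
  have "\<exists>m. g m = h (a v)" if "v \<in> V" for v
  proof -
    have "h (a v) \<in> range g" unfolding M(3) using ord_iso_in_Field[OF h] a that by blast
    then show ?thesis by auto
  qed
  then obtain \<sigma> where \<sigma>: "\<And>v. v \<in> V \<Longrightarrow> g (\<sigma> v) = h (a v)" by metis
  obtain N where N: "\<And>v. v \<in> V \<Longrightarrow> v < N"
    using V by (auto simp: finite_nat_set_iff_bounded)
  define l where "l = map \<sigma> [0..<N]"
  have \<tau>: "\<tau> l v = \<sigma> v" if "v \<in> V" for v using N[OF that] by (simp add: \<tau>_def l_def)
  obtain \<theta> where \<theta>: "\<theta> \<in> p" "\<not> sat M (g \<circ> \<tau> l) \<theta>"
    using bspec[OF met, of "S l"] by (auto simp: S_def sat_ren)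
  have "sat M (g \<circ> \<tau> l) \<theta> = sat M (h \<circ> a) \<theta>"
    by (rule sat_cong) (use \<theta>(1) \<tau> \<sigma> in \<open>auto simp: p_def\<close>)
  also have "\<dots> = sat r a \<theta>"
    using same_typeD[OF same_type_ord_iso[OF h a], of \<theta>] \<theta>(1) by (simp add: p_def)
  finally show False using \<theta> by (simp add: p_def)
qed

definition finite_types :: "'a rel \<Rightarrow> bool" where
  "finite_types r \<longleftrightarrow>
     (\<forall>V. finite V \<longrightarrow> (\<exists>E. finite E \<and> (\<forall>a. a ` V \<subseteq> Field r \<longrightarrow>
        (\<exists>e\<in>E. e ` V \<subseteq> Field r \<and> same_type V r a r e))))"

text \<open>If finitely many tuples never exhaust the types, the negations of all isolating formulas
  are finitely satisfiable. A model realizing them together has a tuple of non-isolated type, while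
  categoricity makes every type isolated.\<close>

theorem categorical_finite_types:
  fixes r :: "'a rel"
  assumes po: "Partial_order r" and cat: "categorical r" and ne: "Field r \<noteq> {}"
  shows "finite_types r"
  unfolding finite_types_def
proof (intro allI impI)
  fix V :: "nat set" assume V: "finite V"
  show "\<exists>E. finite E \<and> (\<forall>a. a ` V \<subseteq> Field r \<longrightarrow>
        (\<exists>e\<in>E. e ` V \<subseteq> Field r \<and> same_type V r a r e))"
  proof (rule ccontr)
    assume "\<not> ?thesis"
    then have new: "\<exists>a. a ` V \<subseteq> Field r \<and> (\<forall>e\<in>E. e ` V \<subseteq> Field r \<longrightarrow> \<not> same_type V r a r e)"
      if "finite E" for E
      unfolding not_ex de_Morgan_conj not_all not_imp bex_simps using that by metis
    obtain x0 where x0: "x0 \<in> Field r" using ne by blast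
    define \<Delta> where "\<Delta> = Neg ` {\<phi>. isolates r V \<phi>}"
    have Verum: "jointly_sat r \<Delta> Verum"
      unfolding jointly_sat_def
    proof (intro allI impI)
      fix F assume F: "finite F" "F \<subseteq> \<Delta>"
      \<comment> \<open>For each \<delta> in \<open>F\<close> one tuple refuting it is picked, if
        there is any. All such tuples share one type, so avoiding the types of the picked ones makes
        \<open>a\<close> satisfy \<open>F\<close>.\<close>
      obtain a where a: "a ` V \<subseteq> Field r" "\<And>\<delta>. \<delta> \<in> F \<Longrightarrow>
          (SOME e. e ` V \<subseteq> Field r \<and> \<not> sat r e \<delta>) ` V \<subseteq> Field r \<Longrightarrow>
          \<not> same_type V r a r (SOME e. e ` V \<subseteq> Field r \<and> \<not> sat r e \<delta>)"
        using new[of "(\<lambda>\<delta>. SOME e. e ` V \<subseteq> Field r \<and> \<not> sat r e \<delta>) ` F"] F(1) by auto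
      define b where "b = override_on (\<lambda>_. x0) a V"
      have b: "range b \<subseteq> Field r" using a(1) x0 by (auto simp: b_def override_on_def)
      have ab: "same_type V r a r b" by (rule same_type_cong) (simp add: b_def)
      have "sat r b \<delta>" if \<delta>: "\<delta> \<in> F" for \<delta>
      proof (rule ccontr)
        assume neg: "\<not> sat r b \<delta>"
        obtain \<phi> where \<phi>: "\<delta> = Neg \<phi>" "isolates r V \<phi>" using \<delta> F(2) by (auto simp: \<Delta>_def)
        have bV: "b ` V \<subseteq> Field r" using b by auto
        let ?e = "SOME e. e ` V \<subseteq> Field r \<and> \<not> sat r e \<delta>"
        have "\<exists>e. e ` V \<subseteq> Field r \<and> \<not> sat r e \<delta>" using bV neg by blast
        then have e: "?e ` V \<subseteq> Field r \<and> \<not> sat r ?e \<delta>" by (rule someI_ex)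
        then have "same_type V r b r ?e"
          using \<phi> neg bV unfolding isolates_def by simp
        then have "same_type V r a r ?e" by (rule same_type_trans[OF ab])
        then show False using a(2)[OF \<delta>] e by simp
      qed
      then show "\<exists>e. range e \<subseteq> Field r \<and> sat r e Verum \<and> (\<forall>\<psi>\<in>F. sat r e \<psi>)"
        using b by (intro exI[of _ b]) simp
    qed
    have fv: "fvars \<delta> \<subseteq> V" if "\<delta> \<in> \<Delta>" for \<delta> using that by (auto simp: \<Delta>_def isolates_def)
    have "\<exists>(M :: nat rel) g. Partial_order M \<and> Th M = Th r \<and> range g = Field M \<and>
        (\<forall>\<delta>\<in>\<Delta>. sat M g \<delta>) \<and> (\<forall>S\<in>{}. \<exists>\<chi>\<in>S. sat M g \<chi>)"
      by (rule realize_and_omit[OF po V fv Verum]) simp_all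
    then obtain M :: "nat rel" and g where M: "Partial_order M" "Th M = Th r" "range g = Field M"
      and met: "\<forall>\<delta>\<in>\<Delta>. sat M g \<delta>"
      by (elim exE conjE) (rule that)
    obtain h where h: "ord_iso h M r"
      using cat M(1,2) ord_isomorphic_sym[of r M] by (auto simp: categorical_def ord_isomorphic_iff)
    have g: "g ` V \<subseteq> Field M" unfolding M(3)[symmetric] by blast
    then have "(h \<circ> g) ` V \<subseteq> Field r" using ord_iso_in_Field[OF h] by auto
    then obtain \<phi> where \<phi>: "isolates r V \<phi>" "sat r (h \<circ> g) \<phi>"
      using categorical_atomic[OF po cat ne V] by blast
    then have "sat M g \<phi>"
      using same_typeD[OF same_type_ord_iso[OF h g], of \<phi>] by (simp add: isolates_def)
    then show False using bspec[OF met, of "Neg \<phi>"] \<phi>(1) by (simp add: \<Delta>_def)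
  qed
qed


section \<open>Back and forth\<close>

lemma back_and_forth:
  fixes r s :: "nat rel"
  assumes Field: "\<And>p. p \<in> B \<Longrightarrow> p \<subseteq> Field r \<times> Field s"
    and iso: "\<And>p x y x' y'. p \<in> B \<Longrightarrow> (x, y) \<in> p \<Longrightarrow> (x', y') \<in> p \<Longrightarrow>
      (x = x' \<longleftrightarrow> y = y') \<and> ((x, x') \<in> r \<longleftrightarrow> (y, y') \<in> s)"
    and forth_ext: "\<And>p x. p \<in> B \<Longrightarrow> x \<in> Field r \<Longrightarrow> \<exists>y. insert (x, y) p \<in> B"
    and back_ext: "\<And>p y. p \<in> B \<Longrightarrow> y \<in> Field s \<Longrightarrow> \<exists>x. insert (x, y) p \<in> B"
    and p0: "p0 \<in> B"
  shows "\<exists>h. ord_iso h r s \<and> (\<forall>(x, y)\<in>p0. h x = y)"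
proof -
  \<comment> \<open>The elements are natural numbers, so step \<open>k\<close> can treat the number
    \<open>k\<close> itself on both sides, and no element is missed.\<close>
  have step: "\<exists>q. (q \<in> B \<and> p0 \<subseteq> q) \<and>
      (p \<subseteq> q \<and> (k \<in> Field r \<longrightarrow> k \<in> Domain q) \<and> (k \<in> Field s \<longrightarrow> k \<in> Range q))"
    if p: "p \<in> B \<and> p0 \<subseteq> p" for p k
  proof -
    obtain q where q: "q \<in> B" "p \<subseteq> q" "k \<in> Field r \<longrightarrow> k \<in> Domain q"
    proof (cases "k \<in> Field r")
      case True
      then obtain y where "insert (k, y) p \<in> B" using forth_ext p by blast
      then show thesis by (rule that) auto
    next
      case False
      then show thesis using p that[of p] by simp
    qed
    obtain q' where q': "q' \<in> B" "q \<subseteq> q'" "k \<in> Field s \<longrightarrow> k \<in> Range q'"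
    proof (cases "k \<in> Field s")
      case True
      then obtain x where "insert (x, k) q \<in> B" using back_ext q(1) by blast
      then show thesis by (rule that) auto
    next
      case False
      then show thesis using q that[of q] by simp
    qed
    have "k \<in> Field r \<longrightarrow> k \<in> Domain q'" using q(3) Domain_mono[OF q'(2)] by auto
    then show ?thesis using p q q' by (intro exI[of _ q']) auto
  qed
  have "\<exists>p. p \<in> B \<and> p0 \<subseteq> p" using p0 by auto
  then have "\<exists>P. \<forall>k. (P k \<in> B \<and> p0 \<subseteq> P k) \<and> (P k \<subseteq> P (Suc k) \<and>
      (k \<in> Field r \<longrightarrow> k \<in> Domain (P (Suc k))) \<and> (k \<in> Field s \<longrightarrow> k \<in> Range (P (Suc k))))"
    by (rule dependent_nat_choice[of "\<lambda>_ p. p \<in> B \<and> p0 \<subseteq> p" "\<lambda>k p q. p \<subseteq> q \<and>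
        (k \<in> Field r \<longrightarrow> k \<in> Domain q) \<and> (k \<in> Field s \<longrightarrow> k \<in> Range q)"]) (rule step)
  then obtain P where P: "\<And>k. P k \<in> B \<and> p0 \<subseteq> P k"
    and Q: "\<And>k. P k \<subseteq> P (Suc k) \<and> (k \<in> Field r \<longrightarrow> k \<in> Domain (P (Suc k))) \<and>
      (k \<in> Field s \<longrightarrow> k \<in> Range (P (Suc k)))"
    by auto
  have mono: "P k \<subseteq> P l" if "k \<le> l" for k l using lift_Suc_mono_le[of P] Q that by simp
  define U where "U = (\<Union>k. P k)"
  have U_iso: "(x = x' \<longleftrightarrow> y = y') \<and> ((x, x') \<in> r \<longleftrightarrow> (y, y') \<in> s)"
    if xy: "(x, y) \<in> U" "(x', y') \<in> U" for x y x' y'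
  proof -
    obtain k l where "(x, y) \<in> P k" "(x', y') \<in> P l" using xy by (auto simp: U_def)
    then have "(x, y) \<in> P (max k l)" "(x', y') \<in> P (max k l)"
      using mono[of k "max k l"] mono[of l "max k l"] by auto
    then show ?thesis using iso[of "P (max k l)"] P by simp
  qed
  have U_Field: "U \<subseteq> Field r \<times> Field s" using Field P unfolding U_def by blast
  have "\<exists>y. (x, y) \<in> U" if "x \<in> Field r" for x
    using Q[of x] that unfolding U_def by auto
  then obtain h where h: "\<And>x. x \<in> Field r \<Longrightarrow> (x, h x) \<in> U" by metis
  have surj: "\<exists>x\<in>Field r. h x = y" if y: "y \<in> Field s" for y
  proof -
    obtain x where x: "(x, y) \<in> U" using Q[of y] y unfolding U_def by auto
    then have "x \<in> Field r" using U_Field by auto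
    then show ?thesis using U_iso[OF x h] by auto
  qed
  have "inj_on h (Field r)"
    using U_iso[OF h h] by (auto simp: inj_on_def)
  moreover have "h ` Field r = Field s" using surj h U_Field by auto
  moreover have "(x, x') \<in> r \<longleftrightarrow> (h x, h x') \<in> s" if "x \<in> Field r" "x' \<in> Field r" for x x'
    using U_iso[OF h[OF that(1)] h[OF that(2)]] by simp
  ultimately have "ord_iso h r s" by (simp add: ord_iso_def bij_betw_def)
  moreover have "h x = y" if "(x, y) \<in> p0" for x y
  proof -
    have xy: "(x, y) \<in> U" using P that unfolding U_def by auto
    then have "x \<in> Field r" using U_Field by auto
    then show ?thesis using U_iso[OF xy h] by auto
  qed
  ultimately show ?thesis by (intro exI[of _ h]) auto
qed

definition equivalent_over :: "nat set \<Rightarrow> 'a rel \<Rightarrow> fm \<Rightarrow> fm \<Rightarrow> bool" where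
  "equivalent_over V r \<phi> \<psi> \<longleftrightarrow> (\<forall>a. a ` V \<subseteq> Field r \<longrightarrow> sat r a \<phi> = sat r a \<psi>)"

lemma equivalent_overD:
  "equivalent_over V r \<phi> \<psi> \<Longrightarrow> a ` V \<subseteq> Field r \<Longrightarrow> sat r a \<phi> = sat r a \<psi>"
  by (simp add: equivalent_over_def)

text \<open>Up to equivalence a formula is determined by the set of representatives in
  \<open>E\<close> that satisfy it, and there are finitely many such sets.\<close>

lemma finite_types_basis:
  assumes "finite_types s" and V: "finite V"
  shows "\<exists>F. finite F \<and> (\<forall>\<phi>\<in>F. fvars \<phi> \<subseteq> V) \<and>
    (\<forall>\<theta>. fvars \<theta> \<subseteq> V \<longrightarrow> (\<exists>\<phi>\<in>F. equivalent_over V s \<theta> \<phi>))"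
proof -
  obtain E where E: "finite E"
    "\<And>a. a ` V \<subseteq> Field s \<Longrightarrow> \<exists>e\<in>E. e ` V \<subseteq> Field s \<and> same_type V s a s e"
    using assms unfolding finite_types_def by auto
  define q where "q \<theta> = {e \<in> E. sat s e \<theta>}" for \<theta>
  have "finite (q ` {\<theta>. fvars \<theta> \<subseteq> V})"
    by (rule finite_subset[of _ "Pow E"]) (use E(1) in \<open>auto simp: q_def\<close>)
  then obtain F where F: "F \<subseteq> {\<theta>. fvars \<theta> \<subseteq> V}" "finite F" "q ` {\<theta>. fvars \<theta> \<subseteq> V} = q ` F"
    using finite_subset_image[OF _ subset_refl] by metis
  have "\<exists>\<phi>\<in>F. equivalent_over V s \<theta> \<phi>" if \<theta>: "fvars \<theta> \<subseteq> V" for \<theta>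
  proof -
    have "q \<theta> \<in> q ` F" unfolding F(3)[symmetric] using \<theta> by simp
    then obtain \<phi> where \<phi>: "\<phi> \<in> F" "q \<theta> = q \<phi>" by auto
    then have \<phi>V: "fvars \<phi> \<subseteq> V" using F(1) by auto
    have "sat s a \<theta> = sat s a \<phi>" if "a ` V \<subseteq> Field s" for a
    proof -
      obtain e where e: "e \<in> E" "same_type V s a s e" using E(2)[OF \<open>a ` V \<subseteq> Field s\<close>] by auto
      have "e \<in> q \<theta> \<longleftrightarrow> e \<in> q \<phi>" using \<phi>(2) by simp
      then show ?thesis
        using e(1) same_typeD[OF e(2) \<theta>] same_typeD[OF e(2) \<phi>V] by (simp add: q_def)
    qed
    then show ?thesis using \<phi>(1) by (auto simp: equivalent_over_def)
  qed
  then show ?thesis using F(1,2) by (intro exI[of _ F]) auto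
qed

text \<open>Moves a finite basis of formulas to an elementarily equivalent order that is not assumed
  to have finitely many types.\<close>

lemma equivalent_over_transfer:
  assumes Th: "Th r = Th s" and V: "finite V" "fvars \<phi> \<subseteq> V" "fvars \<psi> \<subseteq> V"
    and eq: "equivalent_over V r \<phi> \<psi>"
  shows "equivalent_over V s \<phi> \<psi>"
  unfolding equivalent_over_def
proof (intro allI impI)
  fix a assume a: "a ` V \<subseteq> Field s"
  let ?iff = "Conj (Neg (Conj \<phi> (Neg \<psi>))) (Neg (Conj \<psi> (Neg \<phi>)))"
  have "sat s a ?iff"
    by (rule valid_transfer[OF Th V(1) _ _ a]) (use V eq in \<open>auto simp: equivalent_over_def\<close>)
  then show "sat s a \<phi> = sat s a \<psi>" by auto
qed

text \<open>A finite basis compresses the type of the tuple extended by \<open>x\<close> into a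
  single formula; that it has a realization is then already part of the type of the tuple.\<close>

lemma same_type_extend:
  assumes F: "finite F" "\<And>\<phi>. \<phi> \<in> F \<Longrightarrow> fvars \<phi> \<subseteq> insert n V"
    and basis: "\<And>\<theta>. fvars \<theta> \<subseteq> insert n V \<Longrightarrow>
      \<exists>\<phi>\<in>F. equivalent_over (insert n V) r \<theta> \<phi> \<and> equivalent_over (insert n V) s \<theta> \<phi>"
    and n: "n \<notin> V" and e: "e ` V \<subseteq> Field r" and f: "f ` V \<subseteq> Field s"
    and type: "same_type V r e s f" and x: "x \<in> Field r"
  shows "\<exists>y\<in>Field s. same_type (insert n V) r (e(n := x)) s (f(n := y))"
proof -
  define S where "S = {\<phi> \<in> F. sat r (e(n := x)) \<phi>}"
  let ?\<chi> = "Exists n (truth_pattern F S)"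
  have "fvars ?\<chi> \<subseteq> V" using F by (auto simp: fvars_truth_pattern)
  moreover have "sat r e ?\<chi>" using x F(1) by (auto simp: sat_truth_pattern S_def)
  ultimately have "sat s f ?\<chi>" using same_typeD[OF type] by blast
  then obtain y where y: "y \<in> Field s"
    and agree: "\<And>\<phi>. \<phi> \<in> F \<Longrightarrow> sat s (f(n := y)) \<phi> = sat r (e(n := x)) \<phi>"
    using F(1) by (auto simp: sat_truth_pattern S_def)
  have ex: "(e(n := x)) ` insert n V \<subseteq> Field r" and fy: "(f(n := y)) ` insert n V \<subseteq> Field s"
    using e f x y n by auto
  have "sat r (e(n := x)) \<theta> = sat s (f(n := y)) \<theta>" if \<theta>: "fvars \<theta> \<subseteq> insert n V" for \<theta>
  proof -
    obtain \<phi> where \<phi>: "\<phi> \<in> F" "equivalent_over (insert n V) r \<theta> \<phi>"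
      "equivalent_over (insert n V) s \<theta> \<phi>"
      using basis[OF \<theta>] by auto
    then show ?thesis
      using agree[OF \<phi>(1)] equivalent_overD[OF \<phi>(2) ex] equivalent_overD[OF \<phi>(3) fy] by simp
  qed
  then show ?thesis using y unfolding same_type_def by auto
qed

text \<open>Serves two purposes: with \<open>r\<close> equal to \<open>s\<close> it conjugates
  tuples of the same type by an automorphism, and with empty \<open>V\<close> it makes elementarily
  equivalent orders isomorphic.\<close>

theorem finite_types_homogeneous:
  fixes r s :: "nat rel"
  assumes fin: "finite_types s" and V: "finite V" "e ` V \<subseteq> Field r" "f ` V \<subseteq> Field s"
    and type: "same_type V r e s f"
  shows "\<exists>h. ord_iso h r s \<and> (\<forall>v\<in>V. h (e v) = f v)"
proof -
  have Th: "Th r = Th s"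
    unfolding Th_eq_iff
  proof (intro allI impI)
    fix \<phi> a b assume \<phi>: "fvars \<phi> = {}"
    show "sat r a \<phi> = sat s b \<phi>"
      using same_typeD[OF type, of \<phi>] sat_sentence[OF \<phi>, of r a e] sat_sentence[OF \<phi>, of s b f] \<phi>
      by simp
  qed
  define pairs where "pairs V e f = (\<lambda>v. (e v, f v)) ` V"
    for V :: "nat set" and e f :: "nat \<Rightarrow> nat"
  \<comment> \<open>A finite partial map is the graph of two tuples indexed by the same variables;
    it is extended by using a fresh variable as index.\<close>
  define B where "B = {pairs V e f | V e f.
    finite V \<and> e ` V \<subseteq> Field r \<and> f ` V \<subseteq> Field s \<and> same_type V r e s f}"
  have BI: "pairs V e f \<in> B"
    if "finite V" "e ` V \<subseteq> Field r" "f ` V \<subseteq> Field s" "same_type V r e s f" for V e f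
    using that unfolding B_def by blast
  have basis: "\<exists>F. finite F \<and> (\<forall>\<phi>\<in>F. fvars \<phi> \<subseteq> V) \<and> (\<forall>\<theta>. fvars \<theta> \<subseteq> V \<longrightarrow>
      (\<exists>\<phi>\<in>F. equivalent_over V r \<theta> \<phi> \<and> equivalent_over V s \<theta> \<phi>))" if "finite V" for V
    using finite_types_basis[OF fin that] equivalent_over_transfer[OF Th[symmetric] that] by metis
  have fresh: "\<exists>n. n \<notin> V" if "finite V" for V :: "nat set"
    using that by (rule ex_new_if_finite[OF infinite_UNIV_nat])
  have pairs_insert: "insert (x, y) (pairs V e f) = pairs (insert n V) (e(n := x)) (f(n := y))"
    if "n \<notin> V" for n x y V e f
    using that unfolding pairs_def by (auto simp: image_iff)
  have "\<exists>h. ord_iso h r s \<and> (\<forall>(x, y)\<in>pairs V e f. h x = y)"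
  proof (rule back_and_forth)
    show "p \<subseteq> Field r \<times> Field s" if "p \<in> B" for p
      using that unfolding B_def pairs_def by auto
    show "(x = x' \<longleftrightarrow> y = y') \<and> ((x, x') \<in> r \<longleftrightarrow> (y, y') \<in> s)"
      if "p \<in> B" and xy: "(x, y) \<in> p" "(x', y') \<in> p" for p x y x' y'
    proof -
      obtain V e f where p: "same_type V r e s f" "p = pairs V e f"
        using \<open>p \<in> B\<close> unfolding B_def by blast
      obtain v w where vw: "v \<in> V" "w \<in> V" "x = e v" "y = f v" "x' = e w" "y' = f w"
        using xy unfolding p(2) pairs_def by auto
      show ?thesis
        using same_typeD[OF p(1), of "Equal v w"] same_typeD[OF p(1), of "Leq v w"] vw by simp
    qed
    show "\<exists>y. insert (x, y) p \<in> B" if p: "p \<in> B" and x: "x \<in> Field r" for p x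
    proof -
      obtain V e f where V: "finite V" "e ` V \<subseteq> Field r" "f ` V \<subseteq> Field s" "same_type V r e s f"
        and p: "p = pairs V e f"
        using p unfolding B_def by blast
      obtain n where n: "n \<notin> V" using fresh[OF V(1)] ..
      obtain F where F: "finite F" "\<forall>\<phi>\<in>F. fvars \<phi> \<subseteq> insert n V"
        "\<forall>\<theta>. fvars \<theta> \<subseteq> insert n V \<longrightarrow>
          (\<exists>\<phi>\<in>F. equivalent_over (insert n V) r \<theta> \<phi> \<and> equivalent_over (insert n V) s \<theta> \<phi>)"
        using basis[of "insert n V"] V(1) by auto
      have "\<exists>y\<in>Field s. same_type (insert n V) r (e(n := x)) s (f(n := y))"
        by (rule same_type_extend[OF F(1) _ _ n V(2-4) x]) (use F(2,3) in auto)
      then obtain y where y: "y \<in> Field s" "same_type (insert n V) r (e(n := x)) s (f(n := y))" ..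
      have "insert (x, y) p \<in> B"
        unfolding p pairs_insert[OF n] by (rule BI) (use V x y n in auto)
      then show ?thesis ..
    qed
    show "\<exists>x. insert (x, y) p \<in> B" if p: "p \<in> B" and y: "y \<in> Field s" for p y
    proof -
      obtain V e f where V: "finite V" "e ` V \<subseteq> Field r" "f ` V \<subseteq> Field s" "same_type V r e s f"
        and p: "p = pairs V e f"
        using p unfolding B_def by blast
      obtain n where n: "n \<notin> V" using fresh[OF V(1)] ..
      obtain F where F: "finite F" "\<forall>\<phi>\<in>F. fvars \<phi> \<subseteq> insert n V"
        "\<forall>\<theta>. fvars \<theta> \<subseteq> insert n V \<longrightarrow>
          (\<exists>\<phi>\<in>F. equivalent_over (insert n V) r \<theta> \<phi> \<and> equivalent_over (insert n V) s \<theta> \<phi>)"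
        using basis[of "insert n V"] V(1) by auto
      have "\<exists>x\<in>Field r. same_type (insert n V) s (f(n := y)) r (e(n := x))"
        by (rule same_type_extend[OF F(1) _ _ n V(3,2) same_type_sym[OF V(4)] y])
          (use F(2,3) in auto)
      then obtain x where x: "x \<in> Field r" "same_type (insert n V) s (f(n := y)) r (e(n := x))" ..
      have "insert (x, y) p \<in> B"
        unfolding p pairs_insert[OF n]
        by (rule BI) (use V x(1) y n same_type_sym[OF x(2)] in auto)
      then show ?thesis ..
    qed
    show "pairs V e f \<in> B" by (rule BI[OF V type])
  qed
  then show ?thesis by (auto simp: pairs_def)
qed


section \<open>Oligomorphic orders\<close>

definition oligomorphic :: "'a rel \<Rightarrow> bool" where
  "oligomorphic r \<longleftrightarrow>
     (\<forall>V :: nat set. finite V \<longrightarrow> (\<exists>E. finite E \<and> (\<forall>a. a ` V \<subseteq> Field r \<longrightarrow>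
        (\<exists>e\<in>E. e ` V \<subseteq> Field r \<and> (\<exists>h. ord_iso h r r \<and> (\<forall>v\<in>V. h (a v) = e v))))))"

text \<open>Orbits are counted through a colouring with finitely many colours in which tuples of
  equal colour are conjugate. One tuple per colour gives the representatives.\<close>

lemma oligomorphicI:
  fixes r :: "'a rel" and c :: "nat set \<Rightarrow> (nat \<Rightarrow> 'a) \<Rightarrow> 'c"
  assumes fin: "\<And>V. finite V \<Longrightarrow> finite (c V ` {a. a ` V \<subseteq> Field r})"
    and iso: "\<And>V a b. finite V \<Longrightarrow> a ` V \<subseteq> Field r \<Longrightarrow> b ` V \<subseteq> Field r \<Longrightarrow> c V a = c V b \<Longrightarrow>
      \<exists>h. ord_iso h r r \<and> (\<forall>v\<in>V. h (a v) = b v)"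
  shows "oligomorphic r"
  unfolding oligomorphic_def
proof (intro allI impI)
  fix V :: "nat set" assume V: "finite V"
  let ?A = "{a. a ` V \<subseteq> Field r}"
  obtain E where E: "E \<subseteq> ?A" "finite E" "c V ` ?A = c V ` E"
    using finite_subset_image[OF fin[OF V] subset_refl] by metis
  have "\<exists>e\<in>E. e ` V \<subseteq> Field r \<and> (\<exists>h. ord_iso h r r \<and> (\<forall>v\<in>V. h (a v) = e v))"
    if a: "a ` V \<subseteq> Field r" for a
  proof -
    have "c V a \<in> c V ` E" unfolding E(3)[symmetric] using a by simp
    then obtain e where e: "e \<in> E" "c V a = c V e" by auto
    then have "e ` V \<subseteq> Field r" using E(1) by auto
    then show ?thesis using iso[OF V a _ e(2)] e(1) by auto
  qed
  then show "\<exists>E. finite E \<and> (\<forall>a. a ` V \<subseteq> Field r \<longrightarrow>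
      (\<exists>e\<in>E. e ` V \<subseteq> Field r \<and> (\<exists>h. ord_iso h r r \<and> (\<forall>v\<in>V. h (a v) = e v))))"
    using E(2) by (intro exI[of _ E]) simp
qed

text \<open>A tuple is coloured by a representative to which some automorphism moves it; tuples of
  equal colour are linked through that representative.\<close>

lemma oligomorphicD:
  fixes r :: "'a rel"
  assumes "oligomorphic r" and V: "finite V"
  shows "\<exists>c :: (nat \<Rightarrow> 'a) \<Rightarrow> (nat \<Rightarrow> 'a). finite (c ` {a. a ` V \<subseteq> Field r}) \<and>
    (\<forall>a b. a ` V \<subseteq> Field r \<longrightarrow> b ` V \<subseteq> Field r \<longrightarrow> c a = c b \<longrightarrow>
       (\<exists>h. ord_iso h r r \<and> (\<forall>v\<in>V. h (a v) = b v)))"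
proof -
  obtain E where E: "finite E" "\<And>a. a ` V \<subseteq> Field r \<Longrightarrow>
      \<exists>e. e \<in> E \<and> (\<exists>h. ord_iso h r r \<and> (\<forall>v\<in>V. h (a v) = e v))"
    using assms unfolding oligomorphic_def by metis
  obtain c where c: "\<And>a. a ` V \<subseteq> Field r \<Longrightarrow>
      c a \<in> E \<and> (\<exists>h. ord_iso h r r \<and> (\<forall>v\<in>V. h (a v) = c a v))"
    using E(2) by metis
  have "finite (c ` {a. a ` V \<subseteq> Field r})"
    by (rule finite_subset[OF _ E(1)]) (use c in auto)
  moreover have "\<exists>h. ord_iso h r r \<and> (\<forall>v\<in>V. h (a v) = b v)"
    if a: "a ` V \<subseteq> Field r" and b: "b ` V \<subseteq> Field r" and ab: "c a = c b" for a b
  proof -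
    obtain h where h: "ord_iso h r r" "\<forall>v\<in>V. h (a v) = c a v" using c[OF a] by auto
    obtain k where k: "ord_iso k r r" "\<forall>v\<in>V. k (b v) = c b v" using c[OF b] by auto
    let ?g = "inv_into (Field r) k \<circ> h"
    have "ord_iso ?g r r" by (rule ord_iso_comp[OF h(1) ord_iso_inv_into[OF k(1)]])
    moreover have "?g (a v) = b v" if v: "v \<in> V" for v
    proof -
      have "inj_on k (Field r)" using k(1) by (simp add: ord_iso_def bij_betw_def)
      moreover have "h (a v) = k (b v)" using h(2) k(2) v ab by simp
      moreover have "b v \<in> Field r" using b v by auto
      ultimately show ?thesis by simp
    qed
    ultimately show ?thesis by (intro exI[of _ ?g]) simp
  qed
  ultimately show ?thesis by (intro exI[of _ c]) simp
qed

lemma oligomorphic_finite: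
  fixes r :: "'a rel"
  assumes "finite (Field r)"
  shows "oligomorphic r"
proof (rule oligomorphicI[where c = "\<lambda>V a. (\<lambda>v. (v, a v)) ` V"])
  fix V :: "nat set" assume V: "finite V"
  show "finite ((\<lambda>a. (\<lambda>v. (v, a v)) ` V) ` {a. a ` V \<subseteq> Field r})"
    by (rule finite_subset[of _ "Pow (V \<times> Field r)"]) (use V assms in auto)
  fix a b :: "nat \<Rightarrow> 'a" assume "(\<lambda>v. (v, a v)) ` V = (\<lambda>v. (v, b v)) ` V"
  then have "\<forall>v\<in>V. a v = b v" by (auto simp: set_eq_iff image_iff)
  then show "\<exists>h. ord_iso h r r \<and> (\<forall>v\<in>V. h (a v) = b v)"
    using ord_iso_id by (intro exI[of _ id]) simp
qed

lemma oligomorphic_isomorphic: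
  assumes "oligomorphic r" and "ord_isomorphic r s"
  shows "oligomorphic s"
  unfolding oligomorphic_def
proof (intro allI impI)
  fix V :: "nat set" assume V: "finite V"
  obtain g where g: "ord_iso g r s" using assms(2) by (auto simp: ord_isomorphic_iff)
  let ?g = "inv_into (Field r) g"
  have g': "ord_iso ?g s r" by (rule ord_iso_inv_into[OF g])
  have gg: "g (?g y) = y" if "y \<in> Field s" for y
    using g that by (auto simp: ord_iso_def bij_betw_def f_inv_into_f)
  have inj: "?g (g x) = x" if "x \<in> Field r" for x
    using g that by (auto simp: ord_iso_def bij_betw_def)
  obtain E where E: "finite E" "\<And>a. a ` V \<subseteq> Field r \<Longrightarrow>
      \<exists>e. e \<in> E \<and> e ` V \<subseteq> Field r \<and> (\<exists>h. ord_iso h r r \<and> (\<forall>v\<in>V. h (a v) = e v))"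
    using assms(1) V unfolding oligomorphic_def by metis
  have "\<exists>e\<in>(\<lambda>e. g \<circ> e) ` E. e ` V \<subseteq> Field s \<and> (\<exists>h. ord_iso h s s \<and> (\<forall>v\<in>V. h (a v) = e v))"
    if a: "a ` V \<subseteq> Field s" for a
  proof -
    have "(?g \<circ> a) ` V \<subseteq> Field r" using a ord_iso_in_Field[OF g'] by auto
    then obtain e h where e: "e \<in> E" "e ` V \<subseteq> Field r"
      and h: "ord_iso h r r" "\<forall>v\<in>V. h (?g (a v)) = e v"
      using E(2)[of "?g \<circ> a"] by auto
    let ?h = "g \<circ> (h \<circ> ?g)"
    have "ord_iso ?h s s" by (rule ord_iso_comp[OF ord_iso_comp[OF g' h(1)] g])
    moreover have "\<forall>v\<in>V. ?h (a v) = (g \<circ> e) v" using h(2) by simp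
    moreover have "(g \<circ> e) ` V \<subseteq> Field s" using e(2) ord_iso_in_Field[OF g] by auto
    ultimately show ?thesis using e(1) by (intro bexI[of _ "g \<circ> e"] conjI exI[of _ ?h]) auto
  qed
  then show "\<exists>E. finite E \<and> (\<forall>a. a ` V \<subseteq> Field s \<longrightarrow>
      (\<exists>e\<in>E. e ` V \<subseteq> Field s \<and> (\<exists>h. ord_iso h s s \<and> (\<forall>v\<in>V. h (a v) = e v))))"
    using E(1) by (intro exI[of _ "(\<lambda>e. g \<circ> e) ` E"]) simp
qed

section \<open>Types, orbits and countable categoricity\<close>

lemma oligomorphic_finite_types:
  assumes "oligomorphic r"
  shows "finite_types r"
  unfolding finite_types_def
proof (intro allI impI)
  fix V :: "nat set" assume V: "finite V"
  obtain E where E: "finite E" "\<And>a. a ` V \<subseteq> Field r \<Longrightarrow>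
      \<exists>e. e \<in> E \<and> e ` V \<subseteq> Field r \<and> (\<exists>h. ord_iso h r r \<and> (\<forall>v\<in>V. h (a v) = e v))"
    using assms(1) V unfolding oligomorphic_def by metis
  have "\<exists>e\<in>E. e ` V \<subseteq> Field r \<and> same_type V r a r e" if a: "a ` V \<subseteq> Field r" for a
  proof -
    obtain e h where e: "e \<in> E" "e ` V \<subseteq> Field r" and h: "ord_iso h r r" "\<forall>v\<in>V. h (a v) = e v"
      using E(2)[OF a] by auto
    have "same_type V r (h \<circ> a) r e" by (rule same_type_cong) (use h(2) in simp)
    then have "same_type V r a r e" by (rule same_type_trans[OF same_type_ord_iso[OF h(1) a]])
    then show ?thesis using e by auto
  qed
  then show "\<exists>E. finite E \<and> (\<forall>a. a ` V \<subseteq> Field r \<longrightarrow>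
      (\<exists>e\<in>E. e ` V \<subseteq> Field r \<and> same_type V r a r e))"
    using E(1) by (intro exI[of _ E]) simp
qed

lemma finite_types_oligomorphic:
  fixes r :: "nat rel"
  assumes "finite_types r"
  shows "oligomorphic r"
  unfolding oligomorphic_def
proof (intro allI impI)
  fix V :: "nat set" assume V: "finite V"
  obtain E where E: "finite E" "\<And>a. a ` V \<subseteq> Field r \<Longrightarrow>
      \<exists>e. e \<in> E \<and> e ` V \<subseteq> Field r \<and> same_type V r a r e"
    using assms(1) V unfolding finite_types_def by metis
  have "\<exists>e\<in>E. e ` V \<subseteq> Field r \<and> (\<exists>h. ord_iso h r r \<and> (\<forall>v\<in>V. h (a v) = e v))"
    if a: "a ` V \<subseteq> Field r" for a
  proof -
    obtain e where e: "e \<in> E" "e ` V \<subseteq> Field r" "same_type V r a r e"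
      using E(2)[OF a] by auto
    then show ?thesis using finite_types_homogeneous[OF assms V a e(2,3)] by auto
  qed
  then show "\<exists>E. finite E \<and> (\<forall>a. a ` V \<subseteq> Field r \<longrightarrow>
      (\<exists>e\<in>E. e ` V \<subseteq> Field r \<and> (\<exists>h. ord_iso h r r \<and> (\<forall>v\<in>V. h (a v) = e v))))"
    using E(1) by (intro exI[of _ E]) simp
qed

lemma oligomorphic_categorical:
  fixes r :: "nat rel"
  assumes "oligomorphic r"
  shows "categorical r"
  unfolding categorical_def
proof (intro allI impI)
  fix M :: "nat rel" assume "Th M = Th r"
  then have type: "same_type {} M (\<lambda>_. 0) r (\<lambda>_. 0)"
    by (simp add: same_type_def Th_eq_iff)
  have "\<exists>h. ord_iso h M r"
    using finite_types_homogeneous[OF oligomorphic_finite_types[OF assms] finite.emptyI _ _ type]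
    by simp
  then have "ord_isomorphic M r" by (auto simp: ord_isomorphic_iff)
  then show "ord_isomorphic r M" by (rule ord_isomorphic_sym)
qed

section \<open>Gluing isomorphisms along a lexicographic sum\<close>

lemma ord_iso_lex_sum:
  assumes X: "disjoint_summands I X" and Y: "disjoint_summands I Y"
    and h: "\<And>i. i \<in> Field I \<Longrightarrow> ord_iso (h i) (X i) (Y i)"
  shows "\<exists>g. ord_iso g (lex_sum I X) (lex_sum I Y) \<and>
    (\<forall>i\<in>Field I. \<forall>x\<in>Field (X i). g x = h i x)"
proof -
  define g where "g x = h (SOME i. i \<in> Field I \<and> x \<in> Field (X i)) x" for x
  have g: "g x = h i x" if i: "i \<in> Field I" and x: "x \<in> Field (X i)" for i x
  proof -
    have "(SOME i. i \<in> Field I \<and> x \<in> Field (X i)) = i"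
    proof (rule some_equality)
      show "i \<in> Field I \<and> x \<in> Field (X i)" using i x ..
      show "j = i" if "j \<in> Field I \<and> x \<in> Field (X j)" for j
        using disjoint_summandsD[OF X _ i _ x] that by simp
    qed
    then show ?thesis by (simp add: g_def)
  qed
  have hF: "h i ` Field (X i) = Field (Y i)" "inj_on (h i) (Field (X i))" if "i \<in> Field I" for i
    using h[OF that] by (simp_all add: ord_iso_def bij_betw_def)
  have gF: "g x \<in> Field (Y i)" if "i \<in> Field I" "x \<in> Field (X i)" for i x
    using g[OF that] hF(1)[OF that(1)] that(2) by auto
  have "inj_on g (Field (lex_sum I X))"
  proof (rule inj_onI)
    fix x y assume xy: "x \<in> Field (lex_sum I X)" "y \<in> Field (lex_sum I X)" "g x = g y"
    then obtain i j where ij: "i \<in> Field I" "x \<in> Field (X i)" "j \<in> Field I" "y \<in> Field (X j)"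
      by (auto simp: Field_lex_sum)
    have "i = j"
      using disjoint_summandsD[OF Y ij(1,3) gF[OF ij(1,2)]] gF[OF ij(3,4)] xy(3) by simp
    then show "x = y" using g ij xy(3) inj_onD[OF hF(2)[OF ij(1)]] by simp
  qed
  moreover have "g ` Field (lex_sum I X) = Field (lex_sum I Y)"
  proof -
    have "g ` Field (X i) = Field (Y i)" if "i \<in> Field I" for i
      using g[OF that] hF(1)[OF that] by simp
    then show ?thesis by (simp add: Field_lex_sum image_UN)
  qed
  moreover have "(x, y) \<in> lex_sum I X \<longleftrightarrow> (g x, g y) \<in> lex_sum I Y"
    if xy: "x \<in> Field (lex_sum I X)" "y \<in> Field (lex_sum I X)" for x y
  proof -
    obtain i j where ij: "i \<in> Field I" "x \<in> Field (X i)" "j \<in> Field I" "y \<in> Field (X j)"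
      using xy by (auto simp: Field_lex_sum)
    have "(x, y) \<in> X i \<longleftrightarrow> (g x, g y) \<in> Y i" if "i = j"
      using h[OF ij(1)] g[OF ij(1)] ij that by (simp add: ord_iso_def)
    then show ?thesis
      using lex_sum_iff[OF X ij(1,3,2,4)] lex_sum_iff[OF Y ij(1,3) gF[OF ij(1,2)] gF[OF ij(3,4)]]
      by simp
  qed
  ultimately have "ord_iso g (lex_sum I X) (lex_sum I Y)" by (simp add: ord_iso_def bij_betw_def)
  then show ?thesis using g by auto
qed

text \<open>The colour of a tuple records which entries lie in which summand and, for each summand,
  the colour of the subtuple there. Tuples of equal colour are conjugate summand by summand, and the
  automorphisms glue.\<close>

theorem oligomorphic_lex_sum:
  fixes X :: "'i \<Rightarrow> 'a rel"
  assumes I: "finite (Field I)" and d: "disjoint_summands I X"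
    and X: "\<And>i. i \<in> Field I \<Longrightarrow> oligomorphic (X i)"
  shows "oligomorphic (lex_sum I X)"
proof -
  have "\<exists>c :: (nat \<Rightarrow> 'a) \<Rightarrow> (nat \<Rightarrow> 'a). i \<in> Field I \<longrightarrow> finite V \<longrightarrow>
      finite (c ` {a. a ` V \<subseteq> Field (X i)}) \<and>
      (\<forall>a b. a ` V \<subseteq> Field (X i) \<longrightarrow> b ` V \<subseteq> Field (X i) \<longrightarrow> c a = c b \<longrightarrow>
       (\<exists>h. ord_iso h (X i) (X i) \<and> (\<forall>v\<in>V. h (a v) = b v)))" for i V
    using oligomorphicD[OF X, of i V] by auto
  then obtain c :: "'i \<Rightarrow> nat set \<Rightarrow> (nat \<Rightarrow> 'a) \<Rightarrow> (nat \<Rightarrow> 'a)"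
    where c: "\<And>i V. i \<in> Field I \<longrightarrow> finite V \<longrightarrow> finite (c i V ` {a. a ` V \<subseteq> Field (X i)}) \<and>
      (\<forall>a b. a ` V \<subseteq> Field (X i) \<longrightarrow> b ` V \<subseteq> Field (X i) \<longrightarrow> c i V a = c i V b \<longrightarrow>
       (\<exists>h. ord_iso h (X i) (X i) \<and> (\<forall>v\<in>V. h (a v) = b v)))"
    by metis
  define W where "W V a i = {v \<in> V. a v \<in> Field (X i)}" for V :: "nat set" and a i
  \<comment> \<open>The dependence on \<open>i\<close> is stored as a graph over
    \<open>Field I\<close>, so that power sets of finite sets bound the colours.\<close>
  define col where "col V a = ({(i, v). i \<in> Field I \<and> v \<in> W V a i},
    (\<lambda>i. (i, c i (W V a i) a)) ` Field I)" for V a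
  show ?thesis
  proof (rule oligomorphicI[where c = col])
    fix V :: "nat set" assume V: "finite V"
    \<comment> \<open>The distribution of \<open>V\<close> over the summands varies with the tuple,
      so colours for all subsets of \<open>V\<close> are collected.\<close>
    define K where "K = (\<Union>i\<in>Field I. \<Union>U\<in>Pow V. c i U ` {a. a ` U \<subseteq> Field (X i)})"
    have "finite (c i U ` {a. a ` U \<subseteq> Field (X i)})" if "i \<in> Field I" "U \<in> Pow V" for i U
      using c[of i U] that V finite_subset by auto
    then have "finite K" unfolding K_def using I V by auto
    then have fin: "finite (Pow (Field I \<times> V) \<times> Pow (Field I \<times> K))" using I V by simp
    have "col V a \<in> Pow (Field I \<times> V) \<times> Pow (Field I \<times> K)" for a
    proof -
      have "c i (W V a i) a \<in> K" if "i \<in> Field I" for i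
      proof -
        have "W V a i \<in> Pow V" "a ` W V a i \<subseteq> Field (X i)" by (auto simp: W_def)
        then show ?thesis unfolding K_def using that by blast
      qed
      then show ?thesis by (auto simp: col_def W_def)
    qed
    then show "finite (col V ` {a. a ` V \<subseteq> Field (lex_sum I X)})"
      using finite_subset[OF _ fin] by blast
    fix a b assume a: "a ` V \<subseteq> Field (lex_sum I X)" and ab: "col V a = col V b"
    have W: "W V a i = W V b i" if "i \<in> Field I" for i
    proof -
      have "{(i, v). i \<in> Field I \<and> v \<in> W V a i} = {(i, v). i \<in> Field I \<and> v \<in> W V b i}"
        using ab by (simp add: col_def)
      then have "(i, v) \<in> {(i, v). i \<in> Field I \<and> v \<in> W V a i} \<longleftrightarrow>
          (i, v) \<in> {(i, v). i \<in> Field I \<and> v \<in> W V b i}" for v by simp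
      then show ?thesis using that by auto
    qed
    have "\<exists>h. ord_iso h (X i) (X i) \<and> (\<forall>v\<in>W V a i. h (a v) = b v)" if i: "i \<in> Field I" for i
    proof -
      have "(\<lambda>i. (i, c i (W V a i) a)) ` Field I = (\<lambda>i. (i, c i (W V b i) b)) ` Field I"
        using ab by (simp add: col_def)
      moreover have "(i, c i (W V a i) a) \<in> (\<lambda>i. (i, c i (W V a i) a)) ` Field I" using i by simp
      ultimately have "(i, c i (W V a i) a) \<in> (\<lambda>i. (i, c i (W V b i) b)) ` Field I" by simp
      then have "c i (W V a i) a = c i (W V a i) b" using W[OF i] by auto
      moreover have "finite (W V a i)" "a ` W V a i \<subseteq> Field (X i)" using V by (auto simp: W_def)
      moreover have "b ` W V a i \<subseteq> Field (X i)" unfolding W[OF i] by (auto simp: W_def)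
      ultimately show ?thesis using c[of i "W V a i"] i by simp
    qed
    then obtain h where h: "\<And>i. i \<in> Field I \<Longrightarrow>
        ord_iso (h i) (X i) (X i) \<and> (\<forall>v\<in>W V a i. h i (a v) = b v)"
      by metis
    obtain g where g: "ord_iso g (lex_sum I X) (lex_sum I X)"
      "\<forall>i\<in>Field I. \<forall>x\<in>Field (X i). g x = h i x"
      using ord_iso_lex_sum[OF d d, of h] h by auto
    have "g (a v) = b v" if v: "v \<in> V" for v
    proof -
      obtain i where i: "i \<in> Field I" "a v \<in> Field (X i)" using a v by (auto simp: Field_lex_sum)
      then show ?thesis using g(2) h[OF i(1)] v by (auto simp: W_def)
    qed
    then show "\<exists>h. ord_iso h (lex_sum I X) (lex_sum I X) \<and> (\<forall>v\<in>V. h (a v) = b v)"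
      using g(1) by auto
  qed
qed


section \<open>Rooted sums\<close>

text \<open>Adding a bottom element is a lexicographic sum over the two-element chain, so the facts
  on order, theory and orbits of sums apply to rooting.\<close>

definition chain2 :: "nat rel" where
  "chain2 = {(0, 0), (0, 1), (1, 1)}"

definition one_plus_summands :: "'a rel \<Rightarrow> nat \<Rightarrow> 'a option rel" where
  "one_plus_summands r i = (if i = 0 then {(None, None)} else copy Some r)"

lemma Field_chain2: "Field chain2 = {0, 1}"
  by (auto simp: chain2_def Field_def)

lemma Partial_order_chain2: "Partial_order chain2"
  unfolding Partial_order_iff by (simp add: Field_chain2) (auto simp: chain2_def)

lemma lex_sum_chain2: "lex_sum chain2 X = X 0 \<union> X 1 \<union> Field (X 0) \<times> Field (X 1)"
proof -
  have "(\<exists>i j. (i, j) \<in> chain2 \<and> i \<noteq> j \<and> P i j) \<longleftrightarrow> P 0 1" for P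
    by (auto simp: chain2_def)
  then show ?thesis unfolding lex_sum_def Field_chain2 by auto
qed

lemma one_plus_eq_lex_sum: "one_plus r = lex_sum chain2 (one_plus_summands r)"
proof -
  have "Field {(None, None)} = {None}" by (auto simp: Field_def)
  then show ?thesis
    unfolding lex_sum_chain2 one_plus_def one_plus_summands_def by (simp add: Field_copy Un_ac)
qed

lemma disjoint_one_plus_summands: "disjoint_summands chain2 (one_plus_summands r)"
  by (auto simp: disjoint_summands_def Field_chain2 one_plus_summands_def Field_copy Field_def[of "{_}"])

lemma one_plus_iff:
  "(Some x, Some y) \<in> one_plus r \<longleftrightarrow> (x, y) \<in> r"
  "(None, Some y) \<in> one_plus r \<longleftrightarrow> y \<in> Field r"
  "(z, None) \<in> one_plus r \<longleftrightarrow> z = None"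
  by (auto simp: one_plus_def copy_def)

lemma Field_one_plus: "Field (one_plus r) = insert None (Some ` Field r)"
  unfolding one_plus_eq_lex_sum Field_lex_sum Field_chain2
  by (auto simp: one_plus_summands_def Field_copy Field_def[of "{_}"])

lemma isomorphic_copy_Some: "ord_isomorphic r (copy Some r)"
  by (rule isomorphic_copy) simp

lemma Partial_order_rooted:
  fixes r :: "'a rel"
  assumes "Partial_order r"
  shows "Partial_order (rooted r)"
proof -
  have c: "Partial_order (copy Some r)"
    by (rule Partial_order_isomorphic[OF assms isomorphic_copy_Some])
  have "Partial_order {(None :: 'a option, None)}" unfolding Partial_order_iff by (auto simp: Field_def)
  then have "Partial_order (one_plus r)"
    unfolding one_plus_eq_lex_sum
    by (intro Partial_order_lex_sum Partial_order_chain2 disjoint_one_plus_summands)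
      (simp add: one_plus_summands_def c)
  then show ?thesis using c by (simp add: rooted_def)
qed

lemma has_least_rooted: "has_least (rooted r)"
proof (cases "has_least r")
  case True
  then obtain x where x: "x \<in> Field r" "\<forall>y\<in>Field r. (x, y) \<in> r" by (auto simp: has_least_def)
  then have "\<forall>y\<in>Field (copy Some r). (Some x, y) \<in> copy Some r"
    by (auto simp: Field_copy copy_iff)
  then show ?thesis
    using True x(1) unfolding has_least_def[of "rooted r"] by (auto simp: rooted_def Field_copy)
next
  case False
  have "\<forall>y\<in>Field (one_plus r). (None, y) \<in> one_plus r"
    by (auto simp: Field_one_plus one_plus_iff)
  then show ?thesis
    using False unfolding has_least_def[of "rooted r"] by (auto simp: rooted_def Field_one_plus)
qed

lemma has_least_sat: "has_least r \<longleftrightarrow> sat r e (Exists 0 (Neg (Exists 1 (Neg (Leq 0 1)))))"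
  by (simp add: has_least_def)

text \<open>This decides which branch of \<open>rooted\<close> is taken and so makes rooting
  compatible with elementary equivalence.\<close>

lemma has_least_Th:
  assumes "Th r = Th s"
  shows "has_least r \<longleftrightarrow> has_least s"
proof -
  have "fvars (Exists 0 (Neg (Exists 1 (Neg (Leq 0 1))))) = {}" by auto
  then show ?thesis
    using assms unfolding Th_eq_iff has_least_sat[of r undefined] has_least_sat[of s undefined]
    by blast
qed

lemma Th_copy: "inj_on f (Field r) \<Longrightarrow> Th (copy f r) = Th r"
  using Th_isomorphic[OF isomorphic_copy] by metis

lemma Th_rooted:
  fixes r :: "'a rel" and s :: "'b rel"
  assumes "Th r = Th s"
  shows "Th (rooted r) = Th (rooted s)"
proof -
  have c: "Th (copy Some r) = Th (copy Some s)" using assms by (simp add: Th_copy)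
  have "ord_iso (\<lambda>_. None) {(None :: 'a option, None)} {(None :: 'b option, None)}"
    by (simp add: ord_iso_def bij_betw_def)
  then have "Th {(None :: 'a option, None)} = Th {(None :: 'b option, None)}"
    by (intro Th_isomorphic) (auto simp: ord_isomorphic_iff)
  then have "Th (one_plus r) = Th (one_plus s)"
    unfolding one_plus_eq_lex_sum
    by (intro Th_lex_sum disjoint_one_plus_summands) (simp add: one_plus_summands_def c)
  then show ?thesis using c has_least_Th[OF assms] by (simp add: rooted_def)
qed

lemma oligomorphic_rooted:
  fixes r :: "'a rel"
  assumes "oligomorphic r"
  shows "oligomorphic (rooted r)"
proof -
  have c: "oligomorphic (copy Some r)"
    by (rule oligomorphic_isomorphic[OF assms isomorphic_copy_Some])
  have "oligomorphic {(None :: 'a option, None)}"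
    by (rule oligomorphic_finite) (simp add: Field_def)
  then have "oligomorphic (one_plus r)"
    unfolding one_plus_eq_lex_sum
    by (intro oligomorphic_lex_sum disjoint_one_plus_summands)
      (simp_all add: one_plus_summands_def c Field_chain2)
  then show ?thesis using c by (simp add: rooted_def)
qed

text \<open>An isomorphism fixes the bottom element \<open>None\<close>; its restriction to the rest
  is the desired one.\<close>

lemma isomorphic_one_plusD:
  assumes "ord_isomorphic (one_plus r) (one_plus s)"
  shows "ord_isomorphic r s"
proof -
  obtain h where h: "ord_iso h (one_plus r) (one_plus s)"
    using assms by (auto simp: ord_isomorphic_iff)
  have inj: "inj_on h (Field (one_plus r))" and im: "h ` Field (one_plus r) = Field (one_plus s)"
    using h by (auto simp: ord_iso_def bij_betw_def)
  have le: "(x, y) \<in> one_plus r \<longleftrightarrow> (h x, h y) \<in> one_plus s"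
    if "x \<in> Field (one_plus r)" "y \<in> Field (one_plus r)" for x y
    using h that by (auto simp: ord_iso_def)
  have hNone: "h None = None"
  proof -
    have "None \<in> h ` Field (one_plus r)" unfolding im by (simp add: Field_one_plus)
    then obtain z where z: "z \<in> Field (one_plus r)" "h z = None" by auto
    then have "(None, z) \<in> one_plus r" by (auto simp: Field_one_plus one_plus_iff)
    then show ?thesis using le[of None z] z by (simp add: Field_one_plus one_plus_iff)
  qed
  have "\<exists>y. y \<in> Field s \<and> h (Some x) = Some y" if x: "x \<in> Field r" for x
  proof -
    have xF: "Some x \<in> Field (one_plus r)" using x by (simp add: Field_one_plus)
    then have "h (Some x) \<noteq> h None" using inj_onD[OF inj, of "Some x" None] by (auto simp: Field_one_plus)
    moreover have "h (Some x) \<in> Field (one_plus s)" using im xF by auto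
    ultimately show ?thesis using hNone by (auto simp: Field_one_plus)
  qed
  then obtain k where k: "\<And>x. x \<in> Field r \<Longrightarrow> k x \<in> Field s \<and> h (Some x) = Some (k x)" by metis
  have "inj_on k (Field r)"
  proof (rule inj_onI)
    fix x y assume xy: "x \<in> Field r" "y \<in> Field r" "k x = k y"
    then have "h (Some x) = h (Some y)" using k by simp
    then show "x = y" using inj_onD[OF inj, of "Some x" "Some y"] xy by (simp add: Field_one_plus)
  qed
  moreover have "k ` Field r = Field s"
  proof
    show "k ` Field r \<subseteq> Field s" using k by auto
    show "Field s \<subseteq> k ` Field r"
    proof
      fix y assume "y \<in> Field s"
      then have "Some y \<in> h ` Field (one_plus r)" unfolding im by (simp add: Field_one_plus)
      then obtain z where z: "z \<in> Field (one_plus r)" "Some y = h z" by auto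
      then obtain x where "z = Some x" "x \<in> Field r" using hNone by (auto simp: Field_one_plus)
      then show "y \<in> k ` Field r" using k[of x] z(2) by auto
    qed
  qed
  moreover have "(x, y) \<in> r \<longleftrightarrow> (k x, k y) \<in> s" if "x \<in> Field r" "y \<in> Field r" for x y
    using le[of "Some x" "Some y"] k[OF that(1)] k[OF that(2)] that
    by (simp add: Field_one_plus one_plus_iff)
  ultimately have "ord_iso k r s" by (simp add: ord_iso_def bij_betw_def)
  then show ?thesis by (auto simp: ord_isomorphic_iff)
qed

text \<open>The hypothesis on least elements excludes the pair of an order without least element and
  its \<open>one_plus\<close>, which become isomorphic after rooting.\<close>

lemma isomorphic_rootedD:
  assumes "ord_isomorphic (rooted r) (rooted s)" and "has_least r \<longleftrightarrow> has_least s"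
  shows "ord_isomorphic r s"
proof (cases "has_least r")
  case True
  then have "ord_isomorphic (copy Some r) (copy Some s)" using assms by (simp add: rooted_def)
  then show ?thesis
    by (meson isomorphic_copy_Some ord_isomorphic_sym ord_isomorphic_trans)
next
  case False
  then show ?thesis using assms isomorphic_one_plusD by (simp add: rooted_def)
qed

section \<open>Sums of rooted copies\<close>

abbreviation rooted_summand :: "('i \<Rightarrow> 'a rel) \<Rightarrow> 'i \<Rightarrow> ('i \<times> 'a option) rel" where
  "rooted_summand X i \<equiv> copy (Pair i) (rooted (X i))"

lemma isomorphic_rooted_summand: "ord_isomorphic (rooted (X i)) (rooted_summand X i)"
  by (rule isomorphic_copy) (simp add: inj_on_def)

lemma disjoint_rooted_summands: "disjoint_summands I (rooted_summand X)"
  by (auto simp: disjoint_summands_def Field_copy)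

lemma Field_rooted_sum: "Field (rooted_sum I X) = (SIGMA i:Field I. Field (rooted (X i)))"
  by (auto simp: rooted_sum_def Field_lex_sum Field_copy)

lemma rooted_sum_iff:
  assumes "i \<in> Field I" "j \<in> Field I" "x \<in> Field (rooted (X i))" "y \<in> Field (rooted (X j))"
  shows "((i, x), (j, y)) \<in> rooted_sum I X \<longleftrightarrow>
    (if i = j then (x, y) \<in> rooted (X i) else (i, j) \<in> I)"
proof -
  have "((i, x), (i, y)) \<in> rooted_summand X i \<longleftrightarrow> (x, y) \<in> rooted (X i)"
    by (auto simp: copy_def)
  moreover have "(i, x) \<in> Field (rooted_summand X i)" "(j, y) \<in> Field (rooted_summand X j)"
    using assms by (simp_all add: Field_copy)
  ultimately show ?thesis
    unfolding rooted_sum_def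
    using lex_sum_iff[OF disjoint_rooted_summands[of I X] assms(1,2), of "(i, x)" "(j, y)"] by auto
qed

lemma Partial_order_rooted_sum:
  assumes "Partial_order I" and "\<And>i. i \<in> Field I \<Longrightarrow> Partial_order (X i)"
  shows "Partial_order (rooted_sum I X)"
  unfolding rooted_sum_def
proof (rule Partial_order_lex_sum[OF assms(1) _ disjoint_rooted_summands])
  show "Partial_order (rooted_summand X i)" if "i \<in> Field I" for i
    using Partial_order_isomorphic[OF Partial_order_rooted[OF assms(2)[OF that]]
        isomorphic_rooted_summand[of X i]] .
qed

lemma Th_rooted_sum:
  assumes "\<And>i. i \<in> Field I \<Longrightarrow> Th (X i) = Th (Y i)"
  shows "Th (rooted_sum I X) = Th (rooted_sum I Y)"
  unfolding rooted_sum_def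
proof (rule Th_lex_sum[OF disjoint_rooted_summands disjoint_rooted_summands])
  fix i assume i: "i \<in> Field I"
  show "Th (rooted_summand X i) = Th (rooted_summand Y i)"
    using Th_rooted[OF assms[OF i]] by (simp add: Th_copy inj_on_def)
qed

lemma oligomorphic_rooted_sum:
  assumes "finite (Field I)" and "\<And>i. i \<in> Field I \<Longrightarrow> oligomorphic (X i)"
  shows "oligomorphic (rooted_sum I X)"
  unfolding rooted_sum_def
proof (rule oligomorphic_lex_sum[OF assms(1) disjoint_rooted_summands])
  show "oligomorphic (rooted_summand X i)" if "i \<in> Field I" for i
    using oligomorphic_isomorphic[OF oligomorphic_rooted[OF assms(2)[OF that]]
        isomorphic_rooted_summand[of X i]] .
qed

section \<open>Recovering the summands from the roots\<close>

text \<open>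
  An element lies in the summand \<open>i\<close> iff the roots \<open>t j\<close> below it are exactly those with \<open>j \<le> i\<close>.
\<close>

definition summand_above :: "'b rel \<Rightarrow> 'i rel \<Rightarrow> ('i \<Rightarrow> 'b) \<Rightarrow> 'i \<Rightarrow> 'b rel" where
  "summand_above Z I t i =
     Restr Z {z \<in> Field Z. \<forall>j\<in>Field I. (t j, z) \<in> Z \<longleftrightarrow> (j, i) \<in> I}"

text \<open>The images of the roots under any isomorphism serve as \<open>t\<close>. The rooted
  summands are thus determined up to isomorphism by \<open>Z\<close>, \<open>I\<close> and the
  values of \<open>t\<close> on \<open>Field I\<close>.\<close>

lemma rooted_sum_roots:
  assumes I: "Partial_order I" and X: "\<And>i. i \<in> Field I \<Longrightarrow> Partial_order (X i)"
    and iso: "ord_isomorphic (rooted_sum I X) Z"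
  shows "\<exists>t. \<forall>i\<in>Field I. ord_isomorphic (rooted (X i)) (summand_above Z I t i)"
proof -
  let ?S = "rooted_sum I X"
  obtain h where h: "ord_iso h ?S Z" using iso by (auto simp: ord_isomorphic_iff)
  have le: "(x, y) \<in> ?S \<longleftrightarrow> (h x, h y) \<in> Z" if "x \<in> Field ?S" "y \<in> Field ?S" for x y
    using h that by (auto simp: ord_iso_def)
  have inj: "inj_on h (Field ?S)" and im: "h ` Field ?S = Field Z"
    using h by (auto simp: ord_iso_def bij_betw_def)
  have Z: "Partial_order Z"
    by (rule Partial_order_isomorphic[OF Partial_order_rooted_sum[OF I X] iso])
  have "\<forall>i. \<exists>x. x \<in> Field (rooted (X i)) \<and> (\<forall>y\<in>Field (rooted (X i)). (x, y) \<in> rooted (X i))"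
    using has_least_rooted unfolding has_least_def by blast
  then obtain root where root: "\<And>i. root i \<in> Field (rooted (X i))"
    "\<And>i y. y \<in> Field (rooted (X i)) \<Longrightarrow> (root i, y) \<in> rooted (X i)" by metis
  define t where "t j = h (j, root j)" for j
  have above: "(t j, h (i, x)) \<in> Z \<longleftrightarrow> (j, i) \<in> I"
    if j: "j \<in> Field I" and i: "i \<in> Field I" "x \<in> Field (rooted (X i))" for i j x
  proof -
    have "(t j, h (i, x)) \<in> Z \<longleftrightarrow> ((j, root j), (i, x)) \<in> ?S"
      unfolding t_def using le[of "(j, root j)" "(i, x)"] root(1) i j by (simp add: Field_rooted_sum)
    also have "\<dots> \<longleftrightarrow> (j, i) \<in> I"
      using rooted_sum_iff[of j I i "root j" X x] j root(1)[of j] root(2)[of x i] i I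
      unfolding Partial_order_iff by auto
    finally show ?thesis .
  qed
  have "ord_isomorphic (rooted (X i)) (summand_above Z I t i)" if i: "i \<in> Field I" for i
  proof -
    define A where "A = {z \<in> Field Z. \<forall>j\<in>Field I. (t j, z) \<in> Z \<longleftrightarrow> (j, i) \<in> I}"
    define k where "k x = h (i, x)" for x
    have "k ` Field (rooted (X i)) = A"
    proof
      show "k ` Field (rooted (X i)) \<subseteq> A"
        using above i im unfolding k_def A_def by (auto simp: Field_rooted_sum)
      show "A \<subseteq> k ` Field (rooted (X i))"
      proof
        fix z assume z: "z \<in> A"
        then have "z \<in> h ` Field ?S" unfolding im by (simp add: A_def)
        then obtain i' x where x: "i' \<in> Field I" "x \<in> Field (rooted (X i'))" "z = h (i', x)"
          by (auto simp: Field_rooted_sum)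
        \<comment> \<open>The same indices lie below \<open>i'\<close> and below \<open>i\<close>,
          so the two are equal by reflexivity and antisymmetry.\<close>
        have *: "(j, i') \<in> I \<longleftrightarrow> (j, i) \<in> I" if "j \<in> Field I" for j
          using above[OF that x(1,2)] z that x(3) by (simp add: A_def)
        have "(i', i) \<in> I" "(i, i') \<in> I"
          using *[OF x(1)] *[OF i] I x(1) i unfolding Partial_order_iff by auto
        then have "i' = i" using I unfolding Partial_order_iff by auto
        then show "z \<in> k ` Field (rooted (X i))" using x by (simp add: k_def)
      qed
    qed
    moreover have "Field (Restr Z A) = A"
    proof -
      have "A \<subseteq> Field Z" by (auto simp: A_def)
      then have "(z, z) \<in> Restr Z A" if "z \<in> A" for z
        using Z that unfolding Partial_order_iff by auto
      then show ?thesis by (auto simp: Field_def)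
    qed
    moreover have "inj_on k (Field (rooted (X i)))"
      using inj i unfolding inj_on_def k_def Field_rooted_sum by auto
    moreover have "(x, y) \<in> rooted (X i) \<longleftrightarrow> (k x, k y) \<in> Z"
      if "x \<in> Field (rooted (X i))" "y \<in> Field (rooted (X i))" for x y
      using rooted_sum_iff[of i I i x X y] le[of "(i, x)" "(i, y)"] that i
      by (simp add: k_def Field_rooted_sum)
    ultimately have "ord_iso k (rooted (X i)) (Restr Z A)"
      unfolding ord_iso_def bij_betw_def by auto
    then show ?thesis unfolding summand_above_def A_def[symmetric] by (auto simp: ord_isomorphic_iff)
  qed
  then show ?thesis by (intro exI[of _ t]) simp
qed

lemma summand_above_cong:
  "(\<And>j. j \<in> Field I \<Longrightarrow> t j = t' j) \<Longrightarrow> summand_above Z I t i = summand_above Z I t' i"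
  unfolding summand_above_def by simp


section \<open>Counting models\<close>

lemma ordIso_cone_iff: "|A| =o cone \<longleftrightarrow> (\<exists>a. A = {a})"
proof
  assume "|A| =o cone"
  then obtain f where "bij_betw f A {()}" unfolding cone_def card_of_ordIso[symmetric] by blast
  then have "inj_on f A" "f ` A = {()}" by (auto simp: bij_betw_def)
  then have "A \<noteq> {}" "\<forall>a\<in>A. \<forall>b\<in>A. a = b" by (auto simp: inj_on_def)
  then show "\<exists>a. A = {a}" by blast
next
  assume "\<exists>a. A = {a}"
  then obtain a where "A = {a}" ..
  then have "bij_betw (\<lambda>_. ()) A {()}" by (simp add: bij_betw_def)
  then show "|A| =o cone" unfolding cone_def card_of_ordIso[symmetric] by blast
qed

lemma continuum_eq: "ctwo ^c natLeq = |UNIV :: (nat \<Rightarrow> bool) set|"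
proof -
  have "Func (Field natLeq) (Field ctwo) = (UNIV :: (nat \<Rightarrow> bool) set)"
    by (simp add: Func_def ctwo_def Field_natLeq Field_card_of)
  then show ?thesis by (simp add: cexp_def)
qed

lemma nat_rel_ordLeq_continuum: "|A :: nat rel set| \<le>o ctwo ^c natLeq"
proof -
  have "inj_on (\<lambda>R n. prod_decode n \<in> R) A"
  proof (rule inj_onI)
    fix R S :: "nat rel" assume eq: "(\<lambda>n. prod_decode n \<in> R) = (\<lambda>n. prod_decode n \<in> S)"
    have "p \<in> R \<longleftrightarrow> p \<in> S" for p using fun_cong[OF eq, of "prod_encode p"] by simp
    then show "R = S" by blast
  qed
  then show ?thesis unfolding continuum_eq card_of_ordLeq[symmetric] by blast
qed

text \<open>The first component of \<open>g\<close> maps \<open>A\<close> to \<open>B\<close>, the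
  second separates the points of a fibre. For infinite \<open>B\<close> the factor
  \<open>nat\<close> is absorbed; a finite \<open>B\<close> would make the continuum
  countable.\<close>

lemma countable_fibres_continuum:
  fixes g :: "'a \<Rightarrow> 'b \<times> nat"
  assumes A: "|A| =o ctwo ^c natLeq" and B: "|B| \<le>o ctwo ^c natLeq"
    and g: "inj_on g A" "g ` A \<subseteq> B \<times> UNIV"
  shows "|B| =o ctwo ^c natLeq"
proof -
  have AB: "|A| \<le>o |B \<times> (UNIV :: nat set)|" using g card_of_ordLeq by blast
  have "infinite B"
  proof
    assume "finite B"
    then have "countable (B \<times> (UNIV :: nat set))" by (simp add: countable_finite)
    then have "countable A" using g countable_subset countable_image_inj_on by metis
    then obtain f :: "'a \<Rightarrow> nat" where "inj_on f A" by (auto simp: countable_def)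
    then have "|A| \<le>o |UNIV :: nat set|" using card_of_ordLeq by blast
    then have "|A| \<le>o natLeq" using card_of_nat ordLeq_ordIso_trans by blast
    then have "ctwo ^c natLeq \<le>o natLeq" using ordIso_ordLeq_trans[OF ordIso_symmetric[OF A]] by blast
    moreover have "natLeq <o ctwo ^c natLeq" by (rule ordLess_ctwo_cexp[OF natLeq_Card_order])
    ultimately show False using not_ordLess_ordLeq by blast
  qed
  then have "|UNIV :: nat set| \<le>o |B|" using infinite_iff_card_of_nat by blast
  then have "|B \<times> (UNIV :: nat set)| =o |B|"
    using card_of_Times_infinite[of B "UNIV :: nat set"] \<open>infinite B\<close> by simp
  then have "|A| \<le>o |B|" using AB ordLeq_ordIso_trans by blast
  then have "ctwo ^c natLeq \<le>o |B|" using ordIso_ordLeq_trans[OF ordIso_symmetric[OF A]] by blast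
  then show ?thesis using B ordIso_iff_ordLeq by blast
qed

section \<open>Isomorphism classes of countable models\<close>

definition model_iso :: "'a rel \<Rightarrow> nat rel rel" where
  "model_iso r = {(s, t). s \<in> countable_models r \<and> t \<in> countable_models r \<and> ord_isomorphic s t}"

lemma equiv_model_iso: "equiv (countable_models r) (model_iso r)"
  by (rule equivI)
    (auto simp: model_iso_def refl_on_def sym_def trans_def ord_isomorphic_refl
      intro: ord_isomorphic_sym ord_isomorphic_trans)

lemma countable_model_types_eq: "countable_model_types r = countable_models r // model_iso r"
  by (simp add: countable_model_types_def model_iso_def)

lemma countable_model_types_image:
  "countable_model_types r = (\<lambda>M. model_iso r `` {M}) ` countable_models r"
  unfolding countable_model_types_eq by (auto simp: quotient_def)

lemma countable_model_types_singleton: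
  assumes "M \<in> countable_models r" and "\<And>N. N \<in> countable_models r \<Longrightarrow> ord_isomorphic M N"
  shows "|countable_model_types r| =o cone"
proof -
  have eq: "model_iso r `` {N} = model_iso r `` {M}" if "N \<in> countable_models r" for N
    by (rule equiv_class_eq[OF equiv_model_iso])
      (use that assms in \<open>auto simp: model_iso_def intro: ord_isomorphic_sym\<close>)
  have "countable_model_types r = (\<lambda>_. model_iso r `` {M}) ` countable_models r"
    unfolding countable_model_types_image by (rule image_cong[OF refl eq])
  also have "\<dots> = {model_iso r `` {M}}" using assms(1) by auto
  finally show ?thesis unfolding ordIso_cone_iff by blast
qed

lemma countable_model_types_cone:
  assumes "|countable_model_types r| =o cone" "M \<in> countable_models r" "N \<in> countable_models r"
  shows "ord_isomorphic M N"
proof -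
  have "model_iso r `` {M} \<in> countable_model_types r" "model_iso r `` {N} \<in> countable_model_types r"
    unfolding countable_model_types_image using assms(2,3) by auto
  then have "model_iso r `` {M} = model_iso r `` {N}"
    using assms(1) unfolding ordIso_cone_iff by auto
  then have "(M, N) \<in> model_iso r"
    using eq_equiv_class_iff[OF equiv_model_iso assms(2,3)] by simp
  then show ?thesis by (simp add: model_iso_def)
qed

lemma countable_model_types_ordLeq: "|countable_model_types r| \<le>o ctwo ^c natLeq"
  unfolding countable_model_types_image
  by (rule ordLeq_transitive[OF card_of_image nat_rel_ordLeq_continuum])

lemma VC_sharp_finite: "finite (Field r) \<Longrightarrow> VC_sharp r"
  unfolding VC_sharp_def num_models_def by (simp add: ordIso_cone_iff)

lemma VC_sharp_infinite:
  "infinite (Field r) \<Longrightarrow> VC_sharp r \<longleftrightarrow>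
     |countable_model_types r| =o cone \<or> |countable_model_types r| =o ctwo ^c natLeq"
  unfolding VC_sharp_def num_models_def by simp

text \<open>For infinite \<open>r\<close> the count is 1 or the continuum, hence not 0. Finiteness
  is passed on so that an infinite \<open>M\<close> can only come from an infinite
  \<open>r\<close>.\<close>

lemma VC_sharp_countable_model:
  assumes "Partial_order r" and "VC_sharp r"
  shows "\<exists>M. M \<in> countable_models r \<and> (finite (Field r) \<longrightarrow> finite (Field M))"
proof (cases "finite (Field r)")
  case True
  then obtain f :: "'a \<Rightarrow> nat" where f: "inj_on f (Field r)"
    using finite_imp_inj_to_nat_seg[OF True] by auto
  have "copy f r \<in> countable_models r"
    unfolding countable_models_iff
    using Th_copy[OF f] Partial_order_isomorphic[OF assms(1) isomorphic_copy[OF f]] by simp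
  moreover have "finite (Field (copy f r))" using True by (simp add: Field_copy)
  ultimately show ?thesis by blast
next
  case False
  have "countable_model_types r \<noteq> {}"
  proof
    assume empty: "countable_model_types r = {}"
    have "\<not> |{} :: nat rel set set| =o ctwo ^c natLeq"
    proof
      assume "|{} :: nat rel set set| =o ctwo ^c natLeq"
      then obtain f :: "nat rel set \<Rightarrow> (nat \<Rightarrow> bool)" where "bij_betw f {} UNIV"
        unfolding continuum_eq card_of_ordIso[symmetric] by blast
      then show False by (simp add: bij_betw_def)
    qed
    then show False
      using assms(2) unfolding VC_sharp_infinite[OF False] empty ordIso_cone_iff by simp
  qed
  then obtain C where "C \<in> countable_model_types r" by blast
  then obtain M where "M \<in> countable_models r"
    unfolding countable_model_types_image by auto
  then show ?thesis using False by blast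
qed

theorem VC_sharp_rooted_sum:
  fixes I :: "nat rel" and X :: "nat \<Rightarrow> 'a rel" and s :: "'b rel"
  assumes I: "Partial_order I" "finite (Field I)"
    and X: "\<And>i. i \<in> Field I \<Longrightarrow> Partial_order (X i) \<and> VC_sharp (X i)"
    and s: "ord_isomorphic s (rooted_sum I X)"
  shows "VC_sharp s"
proof (cases "finite (Field s)")
  case True
  then show ?thesis by (rule VC_sharp_finite)
next
  case infinite: False
  have "\<forall>i\<in>Field I. \<exists>M. M \<in> countable_models (X i) \<and> (finite (Field (X i)) \<longrightarrow> finite (Field M))"
    by (intro ballI VC_sharp_countable_model) (simp_all add: X)
  then obtain Y where Y: "\<And>i. i \<in> Field I \<Longrightarrow> Y i \<in> countable_models (X i)"
    and Yfin: "\<And>i. i \<in> Field I \<Longrightarrow> finite (Field (X i)) \<Longrightarrow> finite (Field (Y i))"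
    by metis
  \<comment> \<open>The sum lives on pairs; \<open>to_nat\<close> moves it to \<open>nat\<close>,
    where models are counted.\<close>
  define N where "N W = copy to_nat (rooted_sum I W)" for W :: "nat \<Rightarrow> nat rel"
  have N_iso: "ord_isomorphic (rooted_sum I W) (N W)" for W
    unfolding N_def by (rule isomorphic_copy) simp
  have N_model: "N W \<in> countable_models s"
    if W: "\<And>i. i \<in> Field I \<Longrightarrow> W i \<in> countable_models (X i)" for W
  proof -
    have "Partial_order (rooted_sum I W)"
      by (rule Partial_order_rooted_sum[OF I(1)]) (use W in \<open>simp add: countable_models_iff\<close>)
    then have "Partial_order (N W)" by (rule Partial_order_isomorphic[OF _ N_iso])
    moreover have "Th (rooted_sum I W) = Th (rooted_sum I X)"
      by (rule Th_rooted_sum) (use W in \<open>simp add: countable_models_iff\<close>)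
    ultimately show ?thesis
      using Th_isomorphic[OF N_iso[of W]] Th_isomorphic[OF s] by (simp add: countable_models_iff)
  qed
  show ?thesis
  proof (cases "\<exists>i\<in>Field I. infinite (Field (X i)) \<and> |countable_model_types (X i)| =o ctwo ^c natLeq")
    case False
    have "oligomorphic (Y i)" if i: "i \<in> Field I" for i
    proof (cases "finite (Field (Y i))")
      case True
      then show ?thesis by (rule oligomorphic_finite)
    next
      case inf: False
      \<comment> \<open>Only for an infinite order does \<open>VC_sharp\<close> speak about models;
        for a finite one the count is 1 by convention.\<close>
      then have "infinite (Field (X i))" using Yfin[OF i] by blast
      then have cone: "|countable_model_types (X i)| =o cone"
        using X[OF i] False i VC_sharp_infinite[of "X i"] by blast
      have Yi: "Partial_order (Y i)" "Th (Y i) = Th (X i)"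
        using Y[OF i] by (simp_all add: countable_models_iff)
      have "categorical (Y i)"
        unfolding categorical_def
      proof (intro allI impI)
        fix M :: "nat rel" assume "Partial_order M" "Th M = Th (Y i)"
        then have "M \<in> countable_models (X i)" using Yi(2) by (simp add: countable_models_iff)
        then show "ord_isomorphic (Y i) M" by (rule countable_model_types_cone[OF cone Y[OF i]])
      qed
      moreover have "Field (Y i) \<noteq> {}" using inf by auto
      ultimately show ?thesis
        using categorical_finite_types[OF Yi(1)] finite_types_oligomorphic by simp
    qed
    then have "oligomorphic (rooted_sum I Y)" by (rule oligomorphic_rooted_sum[OF I(2)])
    then have "categorical (N Y)"
      by (intro oligomorphic_categorical oligomorphic_isomorphic[OF _ N_iso])
    moreover have NY: "N Y \<in> countable_models s" by (rule N_model[OF Y])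
    ultimately have "ord_isomorphic (N Y) M" if "M \<in> countable_models s" for M
      using that by (simp add: categorical_def countable_models_iff)
    then have "|countable_model_types s| =o cone"
      by (rule countable_model_types_singleton[OF NY])
    then show ?thesis using VC_sharp_infinite[OF infinite] by simp
  next
    case True
    then obtain i0 where i0: "i0 \<in> Field I" "|countable_model_types (X i0)| =o ctwo ^c natLeq"
      by blast
    let ?A = "countable_model_types (X i0)" and ?B = "countable_model_types s"
    \<comment> \<open>A fixed listing of the indices turns the tuple of roots into a list of
      numbers, which is coded by one number.\<close>
    obtain js where js: "set js = Field I" using finite_list[OF I(2)] by blast
    have "\<exists>M. M \<in> countable_models (X i0) \<and> C = model_iso (X i0) `` {M}" if "C \<in> ?A" for C
      using that unfolding countable_model_types_image by auto
    then obtain \<rho> where \<rho>: "\<And>C. C \<in> ?A \<Longrightarrow> \<rho> C \<in> countable_models (X i0)"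
      and \<rho>_class: "\<And>C. C \<in> ?A \<Longrightarrow> C = model_iso (X i0) `` {\<rho> C}" by metis
    define Z where "Z C = Y(i0 := \<rho> C)" for C
    define K where "K C = model_iso s `` {N (Z C)}" for C
    \<comment> \<open>The representative depends on the class alone, so that isomorphic sums built
      from different \<open>C\<close> are compared inside one and the same order.\<close>
    define \<kappa> where "\<kappa> D = (SOME M. M \<in> D)" for D :: "nat rel set"
    have Z: "Z C i \<in> countable_models (X i)" if "C \<in> ?A" "i \<in> Field I" for C i
      using Y \<rho> that by (simp add: Z_def)
    have NZ: "N (Z C) \<in> countable_models s" if "C \<in> ?A" for C
      by (rule N_model) (rule Z[OF that])
    have K: "K C \<in> ?B" if "C \<in> ?A" for C
      unfolding K_def countable_model_types_image using NZ[OF that] by simp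
    have K_iso: "ord_isomorphic (N (Z C)) M" if "M \<in> K C" for C M
      using that by (simp add: K_def model_iso_def)
    have \<kappa>: "ord_isomorphic (rooted_sum I (Z C)) (\<kappa> (K C))" if "C \<in> ?A" for C
    proof -
      have "N (Z C) \<in> K C"
        unfolding K_def using equiv_class_self[OF equiv_model_iso NZ[OF that]] .
      then have "\<kappa> (K C) \<in> K C" unfolding \<kappa>_def by (rule someI)
      then have "ord_isomorphic (N (Z C)) (\<kappa> (K C))" by (rule K_iso)
      then show ?thesis by (rule ord_isomorphic_trans[OF N_iso])
    qed
    have "\<exists>t. \<forall>i\<in>Field I. ord_isomorphic (rooted (Z C i)) (summand_above (\<kappa> (K C)) I t i)"
      if "C \<in> ?A" for C
      by (rule rooted_sum_roots[OF I(1) _ \<kappa>[OF that]])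
        (use Z[OF that] in \<open>simp add: countable_models_iff\<close>)
    then obtain t where t: "\<And>C. C \<in> ?A \<Longrightarrow>
        \<forall>i\<in>Field I. ord_isomorphic (rooted (Z C i)) (summand_above (\<kappa> (K C)) I (t C) i)"
      by metis
    define g where "g C = (K C, to_nat (map (t C) js))" for C
    have "inj_on g ?A"
    proof (rule inj_onI)
      fix C D assume C: "C \<in> ?A" and D: "D \<in> ?A" and eq: "g C = g D"
      have KK: "K C = K D" using eq by (simp add: g_def)
      have "map (t C) js = map (t D) js" using eq by (simp add: g_def)
      then have "t C j = t D j" if "j \<in> Field I" for j using that js by auto
      \<comment> \<open>The same order and the same roots cut out the same summand at
        \<open>i0\<close>.\<close>
      then have "summand_above (\<kappa> (K C)) I (t C) i0 = summand_above (\<kappa> (K D)) I (t D) i0"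
        unfolding KK by (rule summand_above_cong)
      then have "ord_isomorphic (rooted (\<rho> C)) (summand_above (\<kappa> (K D)) I (t D) i0)"
        using bspec[OF t[OF C] i0(1)] by (simp add: Z_def)
      moreover have "ord_isomorphic (summand_above (\<kappa> (K D)) I (t D) i0) (rooted (\<rho> D))"
        using ord_isomorphic_sym[OF bspec[OF t[OF D] i0(1)]] by (simp add: Z_def)
      ultimately have rooted: "ord_isomorphic (rooted (\<rho> C)) (rooted (\<rho> D))"
        by (rule ord_isomorphic_trans)
      \<comment> \<open>Both are models of the theory of \<open>X i0\<close>, so they agree on
        having a least element and rooting can be undone.\<close>
      have "Th (\<rho> C) = Th (\<rho> D)" using \<rho>[OF C] \<rho>[OF D] by (simp add: countable_models_iff)
      then have "ord_isomorphic (\<rho> C) (\<rho> D)"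
        by (intro isomorphic_rootedD[OF rooted] has_least_Th)
      then have "(\<rho> C, \<rho> D) \<in> model_iso (X i0)" using \<rho>[OF C] \<rho>[OF D] by (simp add: model_iso_def)
      then have "model_iso (X i0) `` {\<rho> C} = model_iso (X i0) `` {\<rho> D}"
        by (rule equiv_class_eq[OF equiv_model_iso])
      then show "C = D" using \<rho>_class[OF C] \<rho>_class[OF D] by simp
    qed
    moreover have "g ` ?A \<subseteq> ?B \<times> UNIV" using K by (auto simp: g_def)
    ultimately have "|?B| =o ctwo ^c natLeq"
      by (rule countable_fibres_continuum[OF i0(2) countable_model_types_ordLeq])
    then show ?thesis using VC_sharp_infinite[OF infinite] by simp
  qed
qed

section \<open>Closure under iterated sums\<close>

lemma VC_sharp_rooted_sum_closure:
  assumes "\<forall>r\<in>\<C>. Partial_order r" and "\<forall>r\<in>\<C>. VC_sharp r" and "r \<in> rooted_sum_closure \<C>"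
  shows "Partial_order r \<and> VC_sharp r"
proof -
  have "\<forall>r\<in>sum_level \<C> n. Partial_order r \<and> VC_sharp r" for n
  \<comment> \<open>A level draws its summands from all earlier levels, so the induction has to be
    strong.\<close>
  proof (induction n rule: less_induct)
    case (less n)
    show ?case
    proof (cases n)
      case 0
      then show ?thesis using assms(1,2) by simp
    next
      case (Suc m)
      show ?thesis
      proof
        fix r assume "r \<in> sum_level \<C> n"
        then obtain I :: "nat rel" and X where r: "Partial_order r" "Partial_order I" "finite (Field I)"
          and X: "\<forall>i\<in>Field I. X i \<in> (\<Union>k\<in>{..m}. sum_level \<C> k)"
          and iso: "ord_isomorphic r (rooted_sum I X)"
          unfolding Suc sum_level.simps rooted_sums_def by blast
        have "Partial_order (X i) \<and> VC_sharp (X i)" if i: "i \<in> Field I" for i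
        proof -
          obtain k where "k \<le> m" "X i \<in> sum_level \<C> k" using X i by auto
          then show ?thesis using less.IH[of k] Suc by simp
        qed
        then have "VC_sharp r" by (rule VC_sharp_rooted_sum[OF r(2,3) _ iso])
        then show "Partial_order r \<and> VC_sharp r" using r(1) by simp
      qed
    qed
  qed
  then show ?thesis using assms(3) by (auto simp: rooted_sum_closure_def)
qed

theorem theorem5p4:
  shows "(\<forall>\<C> :: 'a rel set.
            (\<forall>r\<in>\<C>. Partial_order r) \<and> iso_closed \<C> \<and> (\<forall>r\<in>\<C>. VC_sharp r) \<longrightarrow>
            (\<forall>r\<in>rooted_sum_closure \<C>. VC_sharp r)) \<and>
         rooted_sum_closure (VC_sharp_class :: 'a rel set) = VC_sharp_class"
proof
  show "\<forall>\<C> :: 'a rel set.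
      (\<forall>r\<in>\<C>. Partial_order r) \<and> iso_closed \<C> \<and> (\<forall>r\<in>\<C>. VC_sharp r) \<longrightarrow>
      (\<forall>r\<in>rooted_sum_closure \<C>. VC_sharp r)"
    using VC_sharp_rooted_sum_closure by blast
  show "rooted_sum_closure (VC_sharp_class :: 'a rel set) = VC_sharp_class"
  proof
    show "rooted_sum_closure (VC_sharp_class :: 'a rel set) \<subseteq> VC_sharp_class"
    proof
      fix r :: "'a rel" assume "r \<in> rooted_sum_closure VC_sharp_class"
      then have "Partial_order r \<and> VC_sharp r"
        by (rule VC_sharp_rooted_sum_closure[rotated 2]) (simp_all add: VC_sharp_class_def)
      then show "r \<in> VC_sharp_class" by (simp add: VC_sharp_class_def)
    qed
    have "sum_level (VC_sharp_class :: 'a rel set) 0 \<subseteq> rooted_sum_closure VC_sharp_class"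
      unfolding rooted_sum_closure_def by blast
    then show "(VC_sharp_class :: 'a rel set) \<subseteq> rooted_sum_closure VC_sharp_class" by simp
  qed
qed

end
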